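(* Let $(M_t)$ be a right continuous local martingale, $T$ a finite stopping time and $M^T$ the stopped process. 1. Suppose that $\mathbb E\left(\sup_{s\le t}|M_s|^\alpha\right)=\infty$ for some number $\alpha\in(0,1)$. Then $(M_s,\ s\le t)$ is a strict local martingale. 2. Suppose that $\mathbb E\left(\sup_{s\le T}|M_s|^\alpha\right)=\infty$ for some number $\alpha\in(0,1)$ and $T\le t_0$. Then $(M^T_s,\ s\le t_0)$ is a strict local martingale (also $\limsup_{\lambda\to\infty}\lambda\,\mathbb P\left(\sup_{s\le T}|M_s|\ge\lambda\right)=\infty$). If $\lim_{t\to\infty}M_t$ exists we may take $T=\infty$.
   Context: The underlying filtered probability space $(\Omega,\mathcal F,\mathcal F_t,\mathbb P)$ satisfies the standard assumptions: right continuity and completeness. Here $t$ and $t_0$ are deterministic times, and the stopped process is $M^T_s=M_{s\wedge T}$. A strict local martingale is a local martingale which is not a martingale. *)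

theory Defs
  imports "HOL-Probability.Probability" "HOL-Probability.Stopping_Time"
begin

text \<open>
  Time is modelled by \<open>ennreal\<close>, i.e. \<open>[0,\<infinity>]\<close>, so that stopping times may take the value \<open>\<infinity>\<close>
  and a process with a limit can be closed at \<open>\<infinity>\<close>.  Ordinary processes live on the index
  set \<open>{..<\<infinity>}\<close>; their value at \<open>\<infinity>\<close> is then irrelevant.  \<open>F \<infinity>\<close> is the usual
  \<open>\<sigma>\<close>-algebra generated by all \<open>F t\<close> with \<open>t < \<infinity>\<close>.
\<close>

locale usual_filtered_prob_space =
  prob_space P + complete_measure P + filtration "space P" F
  for P :: "'a measure" and F :: "ennreal \<Rightarrow> 'a measure" +
  assumes sets_F_subset: "sets (F t) \<subseteq> sets P"
    and right_continuous_F: "t < \<infinity> \<Longrightarrow> sets (F t) = (\<Inter>u\<in>{t<..}. sets (F u))"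
    and null_sets_F: "null_sets P \<subseteq> sets (F 0)"
    and sets_F_infinity: "sets (F \<infinity>) = sigma_sets (space P) (\<Union>t\<in>{..<\<infinity>}. sets (F t))"

definition adapted_on ::
    "(ennreal \<Rightarrow> 'a measure) \<Rightarrow> ennreal set \<Rightarrow> (ennreal \<Rightarrow> 'a \<Rightarrow> real) \<Rightarrow> bool" where
  "adapted_on F I X \<longleftrightarrow> (\<forall>s\<in>I. X s \<in> borel_measurable (F s))"

definition martingale_on ::
    "'a measure \<Rightarrow> (ennreal \<Rightarrow> 'a measure) \<Rightarrow> ennreal set \<Rightarrow> (ennreal \<Rightarrow> 'a \<Rightarrow> real) \<Rightarrow> bool" where
  "martingale_on P F I X \<longleftrightarrow>
     adapted_on F I X \<and>
     (\<forall>s\<in>I. integrable P (X s)) \<and>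
     (\<forall>s\<in>I. \<forall>u\<in>I. s \<le> u \<longrightarrow> (AE \<omega> in P. real_cond_exp P (F s) (X u) \<omega> = X s \<omega>))"

definition stopped :: "(ennreal \<Rightarrow> 'a \<Rightarrow> real) \<Rightarrow> ('a \<Rightarrow> ennreal) \<Rightarrow> ennreal \<Rightarrow> 'a \<Rightarrow> real" where
  "stopped X T s \<omega> = X (min s (T \<omega>)) \<omega>"

text \<open>
  The factor \<open>indicator {\<omega>. 0 < \<tau> n \<omega>}\<close> is the usual convention that does not force the initial
  value to be integrable; if it is integrable, the factor may be dropped.
  The localizing sequence tends to \<open>\<infinity>\<close>, so for \<open>I = {..t}\<close> with \<open>t < \<infinity>\<close> almost every path of
  the stopped process eventually agrees with that of \<open>X\<close> on all of \<open>I\<close>.  For \<open>I = {..\<infinity>}\<close> the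
  \<open>\<tau> n\<close> may be finite, and it is not required that \<open>\<tau> n = \<infinity>\<close> eventually.
\<close>

definition local_martingale_on ::
    "'a measure \<Rightarrow> (ennreal \<Rightarrow> 'a measure) \<Rightarrow> ennreal set \<Rightarrow> (ennreal \<Rightarrow> 'a \<Rightarrow> real) \<Rightarrow> bool" where
  "local_martingale_on P F I X \<longleftrightarrow>
     adapted_on F I X \<and>
     (\<exists>\<tau> :: nat \<Rightarrow> 'a \<Rightarrow> ennreal.
        (\<forall>n. stopping_time F (\<tau> n)) \<and>
        (AE \<omega> in P. incseq (\<lambda>n. \<tau> n \<omega>) \<and> (\<lambda>n. \<tau> n \<omega>) \<longlonglongrightarrow> \<infinity>) \<and>
        (\<forall>n. martingale_on P F I
               (\<lambda>s \<omega>. indicator {\<omega>. 0 < \<tau> n \<omega>} \<omega> * stopped X (\<tau> n) s \<omega>)))"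

definition strict_local_martingale_on ::
    "'a measure \<Rightarrow> (ennreal \<Rightarrow> 'a measure) \<Rightarrow> ennreal set \<Rightarrow> (ennreal \<Rightarrow> 'a \<Rightarrow> real) \<Rightarrow> bool" where
  "strict_local_martingale_on P F I X \<longleftrightarrow>
     local_martingale_on P F I X \<and> \<not> martingale_on P F I X"

definition right_continuous_paths :: "'a measure \<Rightarrow> (ennreal \<Rightarrow> 'a \<Rightarrow> real) \<Rightarrow> bool" where
  "right_continuous_paths P X \<longleftrightarrow>
     (AE \<omega> in P. \<forall>s<\<infinity>. continuous (at_right s) (\<lambda>u. X u \<omega>))"

text \<open>
  The limit at infinity is taken along real times, since the filter \<open>at_top\<close> on \<open>ennreal\<close> is
  concentrated on the point \<open>\<infinity>\<close>.
\<close>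

definition has_limit_at_infinity :: "'a measure \<Rightarrow> (ennreal \<Rightarrow> 'a \<Rightarrow> real) \<Rightarrow> bool" where
  "has_limit_at_infinity P X \<longleftrightarrow>
     (AE \<omega> in P. \<exists>l. ((\<lambda>r::real. X (ennreal r) \<omega>) \<longlongrightarrow> l) at_top)"

definition closed_at_infinity :: "(ennreal \<Rightarrow> 'a \<Rightarrow> real) \<Rightarrow> ennreal \<Rightarrow> 'a \<Rightarrow> real" where
  "closed_at_infinity X s \<omega> =
     (if s = \<infinity> then Lim at_top (\<lambda>r::real. X (ennreal r) \<omega>) else X s \<omega>)"

definition expected_sup_powr ::
    "'a measure \<Rightarrow> (ennreal \<Rightarrow> 'a \<Rightarrow> real) \<Rightarrow> ('a \<Rightarrow> ennreal) \<Rightarrow> real \<Rightarrow> ennreal" where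
  "expected_sup_powr P X T \<alpha> =
     (\<integral>\<^sup>+ \<omega>. (SUP s\<in>{..T \<omega>}. ennreal (\<bar>X s \<omega>\<bar> powr \<alpha>)) \<partial>P)"

definition sup_tail ::
    "'a measure \<Rightarrow> (ennreal \<Rightarrow> 'a \<Rightarrow> real) \<Rightarrow> ('a \<Rightarrow> ennreal) \<Rightarrow> real \<Rightarrow> real" where
  "sup_tail P X T c =
     \<P>(\<omega> in P. ennreal c \<le> (SUP s\<in>{..T \<omega>}. ennreal \<bar>X s \<omega>\<bar>))"

end

theory Submission
  imports Defs
begin

text \<open>
  The point is the growth of the tail \<open>c * P(Y \<ge> c)\<close> of the maximal function
  \<open>Y = sup\<^sub>s\<^sub>\<le>\<^sub>t \<bar>X s\<bar>\<close>.  For a right-continuous martingale \<open>X\<close> on \<open>{..t}\<close>, Doob's inequality bounds it by a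
  multiple of \<open>E \<bar>X t\<bar>\<close> (\<open>maximal_inequality\<close>).  On the other hand, a bound
  \<open>P(Y \<ge> c) \<le> K / c\<close> makes \<open>E (Y powr \<alpha>)\<close> finite for every \<open>\<alpha> < 1\<close>, by a dyadic decomposition of the range
  of \<open>Y\<close> (\<open>nn_integral_SUP_powr_finite\<close>).  So an infinite moment of order \<open>\<alpha> < 1\<close> forces
  \<open>limsup c * P(Y \<ge> c) = \<infinity>\<close>, and the process cannot be a martingale.  This argument does not
  care whether \<open>t\<close> is finite, and \<open>strict_local_martingale_if_moment_infinite\<close> states it once for all
  three assertions.

  It remains to see that the processes in question are local martingales.  Restriction to a smaller
  set of times is immediate.  For the stopped process the claim is that a stopped right-continuous
  martingale is again a martingale (\<open>martingale_on_stopped\<close>).  The stopping time is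
  rounded up to finite grids, where optional sampling is a finite sum; the sampled values are
  uniformly integrable because their tails are dominated by those of the terminal value, and so
  converge in \<open>L\<^sup>1\<close> (\<open>L1_limit_of_dominated_tails\<close>, \<open>optional_sampling\<close>).  For the process closed at
  infinity, localizing times may be cut off at deterministic finite times, and the stopped processes
  then never see the time \<open>\<infinity>\<close> (\<open>local_martingale_on_closed_at_infinity\<close>).
\<close>

section \<open>Right-continuous paths and countable sets of times\<close>

text \<open>
  A value \<open>\<bar>f s\<bar>\<close> with \<open>s < t\<close> above a bound stays above it on an interval to the right of \<open>s\<close>, and
  such an interval meets every dense set.  The endpoint \<open>t\<close> has no room to its right inside
  \<open>{..t}\<close>, so it has to be added to \<open>D\<close>.
\<close>
lemma SUP_right_continuous_eq_countable:
  fixes f :: "ennreal \<Rightarrow> real"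
  assumes cont: "\<And>s. s < t \<Longrightarrow> continuous (at_right s) f"
    and dense: "\<And>U. open U \<Longrightarrow> U \<noteq> {} \<Longrightarrow> \<exists>d\<in>D. d \<in> U"
  shows "(SUP s\<in>{..t}. ennreal \<bar>f s\<bar>) = (SUP s\<in>insert t (D \<inter> {..t}). ennreal \<bar>f s\<bar>)"
    (is "_ = ?R")
proof (rule antisym)
  show "(SUP s\<in>{..t}. ennreal \<bar>f s\<bar>) \<le> ?R"
  proof (rule SUP_least, rule ccontr)
    fix s assume s: "s \<in> {..t}" and "\<not> ennreal \<bar>f s\<bar> \<le> ?R"
    then have gt: "?R < ennreal \<bar>f s\<bar>" by simp
    have "ennreal \<bar>f t\<bar> \<le> ?R" by (rule SUP_upper) simp
    with gt have "s \<noteq> t" by (metis not_le)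
    with s have "s < t" by auto
    have "((\<lambda>u. ennreal \<bar>f u\<bar>) \<longlongrightarrow> ennreal \<bar>f s\<bar>) (at_right s)"
      using cont[OF \<open>s < t\<close>] unfolding continuous_within
      by (intro tendsto_ennrealI tendsto_rabs)
    then have "eventually (\<lambda>u. ?R < ennreal \<bar>f u\<bar>) (at_right s)"
      using gt by (rule order_tendstoD(1))
    then obtain b where b: "b > s" "\<And>u. s < u \<Longrightarrow> u < b \<Longrightarrow> ?R < ennreal \<bar>f u\<bar>"
      using eventually_at_right[OF \<open>s < t\<close>] by auto
    have "{s<..<min b t} \<noteq> {}"
      using b(1) \<open>s < t\<close> by (simp add: not_le)
    then obtain d where d: "d \<in> D" "s < d" "d < b" "d < t"
      using dense[of "{s<..<min b t}"] by auto
    then have "ennreal \<bar>f d\<bar> \<le> ?R" by (intro SUP_upper) auto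
    with b(2)[OF d(2,3)] show False by simp
  qed
next
  show "?R \<le> (SUP s\<in>{..t}. ennreal \<bar>f s\<bar>)"
    by (rule SUP_subset_mono) auto
qed

text \<open>
  Path properties hold only almost surely, so pathwise limits and suprema agree with measurable
  functions only outside a null set.  Completeness of the filtration makes that harmless.
\<close>
lemma (in complete_measure) measurable_if_AE_eq:
  assumes G: "space G = space M" "null_sets M \<subseteq> sets G"
    and g: "g \<in> borel_measurable G" and ae: "AE x in M. f x = g x"
  shows "f \<in> borel_measurable G"
proof (rule measurableI)
  fix A :: "'b set" assume "A \<in> sets borel"
  define N where "N = {x \<in> space M. f x \<noteq> g x}"
  have N: "N \<in> null_sets M" using ae unfolding AE_iff_null_sets N_def .
  have "f -` A \<inter> N \<in> null_sets M" by (rule complete2[OF _ N]) auto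
  then have "(g -` A \<inter> space G - N) \<union> (f -` A \<inter> N) \<in> sets G"
    using N G(2) measurable_sets[OF g \<open>A \<in> sets borel\<close>] by auto
  also have "(g -` A \<inter> space G - N) \<union> (f -` A \<inter> N) = f -` A \<inter> space G"
    by (auto simp: N_def G(1))
  finally show "f -` A \<inter> space G \<in> sets G" .
qed simp

text \<open>
  Finite sets of times whose gaps close up everywhere below \<open>t\<close>: initial pieces of an enumeration of
  a countable dense set, together with \<open>t\<close>.  In contrast to a dyadic subdivision this works
  verbatim for \<open>t = \<infinity>\<close>.
\<close>
lemma dense_grids:
  fixes t :: ennreal
  shows "\<exists>G. (\<forall>n::nat. finite (G n) \<and> t \<in> G n \<and> G n \<subseteq> {..t}) \<and>
    (\<forall>r b. r < b \<and> b \<le> t \<longrightarrow> (\<exists>N. \<forall>n\<ge>N. \<exists>d\<in>G n. r < d \<and> d < b))"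
proof -
  obtain D :: "ennreal set" where D: "countable D"
    "\<And>U. open U \<Longrightarrow> U \<noteq> {} \<Longrightarrow> \<exists>d\<in>D. d \<in> U"
    using countable_dense_exists by blast
  define G where "G n = insert t (from_nat_into D ` {..n} \<inter> {..t})" for n
  show ?thesis
  proof (rule exI[of _ G], intro conjI allI impI)
    fix r b :: ennreal assume *: "r < b \<and> b \<le> t"
    then have "{r<..<b} \<noteq> {}" using dense_order_class.dense[of r b] by auto
    then obtain d where d: "d \<in> D" "r < d" "d < b" using D(2)[of "{r<..<b}"] by auto
    obtain N where N: "from_nat_into D N = d" using from_nat_into_surj[OF D(1) d(1)] by auto
    have "d \<in> G n" if "n \<ge> N" for n
      using that d * N unfolding G_def by (auto intro!: image_eqI[of _ _ N])
    with d show "\<exists>N. \<forall>n\<ge>N. \<exists>d\<in>G n. r < d \<and> d < b" by blast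
  qed (auto simp: G_def)
qed

text \<open>
  Rounding a time up to a grid preserves stopping times and approximates the time from the right,
  the side on which paths are continuous.  Times beyond \<open>t\<close> are cut off at \<open>t\<close>, so that the
  minimum exists for every grid containing \<open>t\<close>.
\<close>
definition next_grid_point :: "ennreal set \<Rightarrow> ennreal \<Rightarrow> ennreal \<Rightarrow> ennreal" where
  "next_grid_point G t r = Min {d \<in> G. min r t \<le> d}"

lemma next_grid_point:
  assumes "finite G" "t \<in> G" "G \<subseteq> {..t}"
  shows next_grid_point_in: "next_grid_point G t r \<in> G"
    and next_grid_point_ge: "min r t \<le> next_grid_point G t r"
    and next_grid_point_eq_iff:
      "d \<in> G \<Longrightarrow> next_grid_point G t r = d \<longleftrightarrow> (d = t \<or> r \<le> d) \<and> (\<forall>e\<in>G. e < d \<longrightarrow> e < r)"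
proof -
  have ne: "finite {d \<in> G. min r t \<le> d}" "{d \<in> G. min r t \<le> d} \<noteq> {}"
    using assms by (auto intro!: exI[of _ t])
  show "next_grid_point G t r \<in> G" "min r t \<le> next_grid_point G t r"
    using Min_in[OF ne] by (auto simp: next_grid_point_def)
  assume d: "d \<in> G"
  have "d \<le> t" using d assms by auto
  have "next_grid_point G t r = d \<longleftrightarrow> min r t \<le> d \<and> (\<forall>e\<in>G. min r t \<le> e \<longrightarrow> d \<le> e)"
    unfolding next_grid_point_def Min_eq_iff[OF ne] using d by auto
  also have "\<dots> \<longleftrightarrow> (d = t \<or> r \<le> d) \<and> (\<forall>e\<in>G. e < d \<longrightarrow> e < r)"
    using \<open>d \<le> t\<close> by (auto simp: min_le_iff_disj not_le[symmetric])
  finally show "next_grid_point G t r = d \<longleftrightarrow> (d = t \<or> r \<le> d) \<and> (\<forall>e\<in>G. e < d \<longrightarrow> e < r)" .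
qed

lemma next_grid_point_path_tendsto:
  fixes f :: "ennreal \<Rightarrow> real"
  assumes fin: "\<And>n. finite (G n)" and t: "\<And>n. t \<in> G n" and sub: "\<And>n. G n \<subseteq> {..t}"
    and dense: "\<And>r b. r < b \<Longrightarrow> b \<le> t \<Longrightarrow> \<exists>N. \<forall>n\<ge>N. \<exists>d\<in>G n. r < d \<and> d < b"
    and cont: "\<And>s. s < t \<Longrightarrow> continuous (at_right s) f"
  shows "(\<lambda>n. f (next_grid_point (G n) t r)) \<longlonglongrightarrow> f (min r t)"
proof (cases "r < t")
  case False
  then have "next_grid_point (G n) t r = t" for n
    using next_grid_point_in[OF fin t sub, of n r] next_grid_point_ge[OF fin t sub, of r n] sub[of n]
    by (auto simp: min_def not_less intro: antisym split: if_splits)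
  with False show ?thesis by (simp add: min_def)
next
  case True
  have ge: "r \<le> next_grid_point (G n) t r" for n
    using next_grid_point_ge[OF fin t sub, of r n] True by (simp add: min_def split: if_splits)
  have lim: "(\<lambda>n. next_grid_point (G n) t r) \<longlonglongrightarrow> r"
  proof (rule order_tendstoI)
    fix b assume "b < r"
    then show "eventually (\<lambda>n. b < next_grid_point (G n) t r) sequentially"
      using ge by (auto intro: always_eventually less_le_trans)
  next
    fix b assume "r < b"
    then obtain N where N: "\<And>n. n \<ge> N \<Longrightarrow> \<exists>d\<in>G n. r < d \<and> d < b"
      using dense[of r "min b t"] True by (auto simp: Bex_def) metis
    have "next_grid_point (G n) t r < b" if n: "n \<ge> N" for n
    proof -
      obtain d where d: "d \<in> G n" "r < d" "d < b" using N[OF n] by auto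
      have "next_grid_point (G n) t r \<le> d"
        unfolding next_grid_point_def using d fin
        by (intro Min_le) (auto simp: min_le_iff_disj)
      with d show ?thesis by simp
    qed
    then show "eventually (\<lambda>n. next_grid_point (G n) t r < b) sequentially"
      by (auto simp: eventually_sequentially)
  qed
  have "continuous (at r within {r..}) f"
  proof -
    have "{r..} - {r} = {r<..}" "{r<..} - {r} = {r<..}" by auto
    then have "at r within {r..} = at_right r" by (simp add: at_within_def)
    then show ?thesis using cont[OF True] by simp
  qed
  from continuous_within_tendsto_compose[OF this _ lim] show ?thesis
    using ge True by (simp add: min_absorb1)
qed

section \<open>A maximal inequality\<close>

lemma martingale_on_measurable: "martingale_on P F I X \<Longrightarrow> s \<in> I \<Longrightarrow> X s \<in> borel_measurable (F s)"
  by (simp add: martingale_on_def adapted_on_def)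

lemma martingale_on_integrable: "martingale_on P F I X \<Longrightarrow> s \<in> I \<Longrightarrow> integrable P (X s)"
  by (simp add: martingale_on_def)

context usual_filtered_prob_space
begin

lemma null_sets_subset_F: "null_sets P \<subseteq> sets (F s)"
  using null_sets_F sets_F_mono[of 0 s] by auto

lemma subalgebra_F: "subalgebra P (F s)"
  using space_F sets_F_subset by (auto simp: subalgebra_def)

lemma measurable_F_mono: "f \<in> borel_measurable (F s) \<Longrightarrow> s \<le> u \<Longrightarrow> f \<in> borel_measurable (F u)"
  using sets_F_mono[of s u] space_F by (auto simp: measurable_def)

lemma set_integral_martingale:
  assumes X: "martingale_on P F I X" and I: "s \<in> I" "u \<in> I" "s \<le> u" and A: "A \<in> sets (F s)"
  shows "(\<integral>\<omega>. indicator A \<omega> * X s \<omega> \<partial>P) = (\<integral>\<omega>. indicator A \<omega> * X u \<omega> \<partial>P)"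
proof -
  interpret S: finite_measure_subalgebra P "F s"
    by standard (rule subalgebra_F)
  have [measurable]: "A \<in> sets P" using A sets_F_subset by auto
  have int: "integrable P (X s)" "integrable P (X u)"
    and ae: "AE \<omega> in P. real_cond_exp P (F s) (X u) \<omega> = X s \<omega>"
    using X I by (auto simp: martingale_on_def)
  have [measurable]: "X s \<in> borel_measurable P" using int(1) by simp
  have "(\<integral>\<omega>. indicator A \<omega> * X u \<omega> \<partial>P) = (\<integral>\<omega>. indicator A \<omega> * real_cond_exp P (F s) (X u) \<omega> \<partial>P)"
    using S.real_cond_exp_intA[OF int(2) A] by (simp add: set_lebesgue_integral_def)
  also have "\<dots> = (\<integral>\<omega>. indicator A \<omega> * X s \<omega> \<partial>P)"
    using ae by (intro integral_cong_AE) auto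
  finally show ?thesis by simp
qed

text \<open>
  The submartingale property of \<open>\<bar>X\<bar>\<close>: on the two \<open>F s\<close>-measurable parts of \<open>A\<close> where \<open>X s\<close> has a
  fixed sign, \<open>\<bar>X s\<bar> = \<plusminus> X s\<close> integrates to the same value as \<open>\<plusminus> X u\<close>, which is at most \<open>\<bar>X u\<bar>\<close>.
\<close>
lemma set_integral_abs_martingale_mono:
  assumes X: "martingale_on P F I X" and I: "s \<in> I" "u \<in> I" "s \<le> u" and A: "A \<in> sets (F s)"
  shows "(\<integral>\<omega>. indicator A \<omega> * \<bar>X s \<omega>\<bar> \<partial>P) \<le> (\<integral>\<omega>. indicator A \<omega> * \<bar>X u \<omega>\<bar> \<partial>P)"
proof -
  have int: "integrable P (X s)" "integrable P (X u)" and [measurable]: "X s \<in> borel_measurable (F s)"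
    using X I by (auto simp: martingale_on_def adapted_on_def)
  define B where "B = {\<omega> \<in> space (F s). 0 \<le> X s \<omega>}"
  have B: "B \<in> sets (F s)" unfolding B_def by measurable
  have [measurable]: "A \<in> sets P" "B \<in> sets P" using A B sets_F_subset by auto
  have AB: "A \<inter> B \<in> sets (F s)" "A - B \<in> sets (F s)" using A B by auto
  have i: "integrable P (\<lambda>\<omega>. indicator C \<omega> * X v \<omega>)" if "C \<in> sets P" "v \<in> {s, u}" for C v
    using integrable_real_mult_indicator[OF that(1), of "X v"] that(2) int by (auto simp: mult.commute)
  have "(\<integral>\<omega>. indicator A \<omega> * \<bar>X s \<omega>\<bar> \<partial>P) =
      (\<integral>\<omega>. indicator (A \<inter> B) \<omega> * X s \<omega> - indicator (A - B) \<omega> * X s \<omega> \<partial>P)"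
    by (intro Bochner_Integration.integral_cong) (auto simp: indicator_def B_def space_F)
  also have "\<dots> = (\<integral>\<omega>. indicator (A \<inter> B) \<omega> * X s \<omega> \<partial>P) - (\<integral>\<omega>. indicator (A - B) \<omega> * X s \<omega> \<partial>P)"
    by (intro Bochner_Integration.integral_diff i) auto
  also have "\<dots> = (\<integral>\<omega>. indicator (A \<inter> B) \<omega> * X u \<omega> \<partial>P) - (\<integral>\<omega>. indicator (A - B) \<omega> * X u \<omega> \<partial>P)"
    using set_integral_martingale[OF X I AB(1)] set_integral_martingale[OF X I AB(2)] by simp
  also have "\<dots> = (\<integral>\<omega>. indicator (A \<inter> B) \<omega> * X u \<omega> - indicator (A - B) \<omega> * X u \<omega> \<partial>P)"
    by (intro Bochner_Integration.integral_diff[symmetric] i) auto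
  also have "\<dots> \<le> (\<integral>\<omega>. indicator A \<omega> * \<bar>X u \<omega>\<bar> \<partial>P)"
  proof (rule integral_mono)
    show "integrable P (\<lambda>\<omega>. indicator A \<omega> * \<bar>X u \<omega>\<bar>)"
      using integrable_real_mult_indicator[of A P "\<lambda>\<omega>. \<bar>X u \<omega>\<bar>"] int by (simp add: mult.commute)
    show "integrable P (\<lambda>\<omega>. indicator (A \<inter> B) \<omega> * X u \<omega> - indicator (A - B) \<omega> * X u \<omega>)"
      by (intro Bochner_Integration.integrable_diff i) auto
  qed (auto simp: indicator_def)
  finally show ?thesis .
qed

text \<open>
  Optional sampling at a finitely valued time, localized to a set \<open>A\<close>: split \<open>A\<close> by the value of \<open>S\<close>
  and use the martingale property on each piece.  The measurability hypothesis is stated for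
  \<open>A\<close> and \<open>S\<close> jointly, so that \<open>S\<close> only has to make sense on \<open>A\<close>.  This form yields both the
  maximal inequality, with \<open>S\<close> the first passage over a level, and optional sampling at general
  stopping times.
\<close>
lemma martingale_at_simple_time:
  assumes X: "martingale_on P F I X" and D: "finite D" "D \<subseteq> I" and u: "u \<in> I" "\<And>d. d \<in> D \<Longrightarrow> d \<le> u"
    and S: "\<And>\<omega>. \<omega> \<in> A \<Longrightarrow> S \<omega> \<in> D" "\<And>d. d \<in> D \<Longrightarrow> A \<inter> {\<omega>. S \<omega> = d} \<in> sets (F d)"
  shows "integrable P (\<lambda>\<omega>. indicator A \<omega> * X (S \<omega>) \<omega>)"
    and "(\<integral>\<omega>. indicator A \<omega> * X (S \<omega>) \<omega> \<partial>P) = (\<integral>\<omega>. indicator A \<omega> * X u \<omega> \<partial>P)"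
    and "(\<integral>\<omega>. indicator A \<omega> * \<bar>X (S \<omega>) \<omega>\<bar> \<partial>P) \<le> (\<integral>\<omega>. indicator A \<omega> * \<bar>X u \<omega>\<bar> \<partial>P)"
proof -
  let ?A = "\<lambda>d. A \<inter> {\<omega>. S \<omega> = d}"
  have split: "indicator A \<omega> * h (S \<omega>) \<omega> = (\<Sum>d\<in>D. indicator (?A d) \<omega> * h d \<omega>)"
    for h :: "ennreal \<Rightarrow> 'a \<Rightarrow> real" and \<omega>
  proof (cases "\<omega> \<in> A")
    case True
    then have "(\<Sum>d\<in>D. indicator (?A d) \<omega> * h d \<omega>) = (\<Sum>d\<in>D. if d = S \<omega> then h d \<omega> else 0)"
      by (intro sum.cong) (auto simp: indicator_def)
    with True S(1) D(1) show ?thesis by (simp add: sum.delta')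
  qed simp
  have int: "integrable P (X d)" if "d \<in> insert u D" for d
    using X that D u by (auto simp: martingale_on_def)
  have m: "?A d \<in> sets P" if "d \<in> D" for d using S(2)[OF that] sets_F_subset by auto
  have i: "integrable P (\<lambda>\<omega>. indicator (?A d) \<omega> * X e \<omega>)" 
     "integrable P (\<lambda>\<omega>. indicator (?A d) \<omega> * \<bar>X e \<omega>\<bar>)" if "d \<in> D" "e \<in> insert u D" for d e
    using integrable_real_mult_indicator[OF m[OF that(1)] int[OF that(2)]]
      integrable_real_mult_indicator[OF m[OF that(1)] integrable_abs[OF int[OF that(2)]]]
    by (simp_all add: mult.commute)
  show "integrable P (\<lambda>\<omega>. indicator A \<omega> * X (S \<omega>) \<omega>)"
    unfolding split using i by (intro Bochner_Integration.integrable_sum) auto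
  have "(\<integral>\<omega>. indicator A \<omega> * X (S \<omega>) \<omega> \<partial>P) = (\<Sum>d\<in>D. \<integral>\<omega>. indicator (?A d) \<omega> * X d \<omega> \<partial>P)"
    unfolding split using i by (intro Bochner_Integration.integral_sum) auto
  also have "\<dots> = (\<Sum>d\<in>D. \<integral>\<omega>. indicator (?A d) \<omega> * X u \<omega> \<partial>P)"
    using D u S by (intro sum.cong refl set_integral_martingale[OF X]) auto
  also have "\<dots> = (\<integral>\<omega>. indicator A \<omega> * X u \<omega> \<partial>P)"
    unfolding split[of _ "\<lambda>_::ennreal. X u"] using i by (intro Bochner_Integration.integral_sum[symmetric]) auto
  finally show "(\<integral>\<omega>. indicator A \<omega> * X (S \<omega>) \<omega> \<partial>P) = (\<integral>\<omega>. indicator A \<omega> * X u \<omega> \<partial>P)" .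
  have "(\<integral>\<omega>. indicator A \<omega> * \<bar>X (S \<omega>) \<omega>\<bar> \<partial>P) = (\<Sum>d\<in>D. \<integral>\<omega>. indicator (?A d) \<omega> * \<bar>X d \<omega>\<bar> \<partial>P)"
    unfolding split[of _ "\<lambda>d \<omega>. \<bar>X d \<omega>\<bar>"] using i by (intro Bochner_Integration.integral_sum) auto
  also have "\<dots> \<le> (\<Sum>d\<in>D. \<integral>\<omega>. indicator (?A d) \<omega> * \<bar>X u \<omega>\<bar> \<partial>P)"
    using D u S by (intro sum_mono set_integral_abs_martingale_mono[OF X]) auto
  also have "\<dots> = (\<integral>\<omega>. indicator A \<omega> * \<bar>X u \<omega>\<bar> \<partial>P)"
    unfolding split[of _ "\<lambda>(_::ennreal) \<omega>. \<bar>X u \<omega>\<bar>"] using i by (intro Bochner_Integration.integral_sum[symmetric]) auto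
  finally show "(\<integral>\<omega>. indicator A \<omega> * \<bar>X (S \<omega>) \<omega>\<bar> \<partial>P) \<le> (\<integral>\<omega>. indicator A \<omega> * \<bar>X u \<omega>\<bar> \<partial>P)" .
qed

lemma maximal_inequality_finite:
  assumes X: "martingale_on P F I X" and D: "finite D" "D \<subseteq> I" and u: "u \<in> I" "\<And>d. d \<in> D \<Longrightarrow> d \<le> u"
    and c: "0 \<le> c"
  shows "c * prob {\<omega> \<in> space P. \<exists>d\<in>D. c < \<bar>X d \<omega>\<bar>} \<le> (\<integral>\<omega>. \<bar>X u \<omega>\<bar> \<partial>P)"
proof -
  define A where "A = {\<omega> \<in> space P. \<exists>d\<in>D. c < \<bar>X d \<omega>\<bar>}"
  \<comment> \<open>the first passage of \<open>\<bar>X\<bar>\<close> over the level \<open>c\<close> within \<open>D\<close>\<close>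
  define S where "S \<omega> = Min {d \<in> D. c < \<bar>X d \<omega>\<bar>}" for \<omega>
  have X_F: "X d \<in> borel_measurable (F e)" if "d \<in> D" "d \<le> e" for d e
  proof (rule measurable_F_mono[OF _ that(2)])
    show "X d \<in> borel_measurable (F d)"
      using martingale_on_measurable[OF X subsetD[OF D(2) that(1)]] .
  qed
  have X_P[measurable]: "X d \<in> borel_measurable P" if "d \<in> D" for d
    using X_F[OF that order_refl] measurable_from_subalg[OF subalgebra_F] by blast
  have A[measurable]: "A \<in> sets P"
    unfolding A_def using D(1) by measurable
  have S_in: "S \<omega> \<in> D \<and> c < \<bar>X (S \<omega>) \<omega>\<bar>" if "\<omega> \<in> A" for \<omega>
    using Min_in[of "{d \<in> D. c < \<bar>X d \<omega>\<bar>}"] that D(1) by (auto simp: A_def S_def)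
  have S_F: "A \<inter> {\<omega>. S \<omega> = d} \<in> sets (F d)" if "d \<in> D" for d
  proof -
    have "A \<inter> {\<omega>. S \<omega> = d} = {\<omega> \<in> space (F d). c < \<bar>X d \<omega>\<bar> \<and> (\<forall>e\<in>D \<inter> {..<d}. \<not> c < \<bar>X e \<omega>\<bar>)}"
    proof (intro set_eqI iffI)
      fix \<omega> assume *: "\<omega> \<in> A \<inter> {\<omega>. S \<omega> = d}"
      have "S \<omega> \<le> e" if "e \<in> D" "c < \<bar>X e \<omega>\<bar>" for e
        unfolding S_def using that D(1) by (intro Min_le) auto
      with * S_in[of \<omega>]
      show "\<omega> \<in> {\<omega> \<in> space (F d). c < \<bar>X d \<omega>\<bar> \<and> (\<forall>e\<in>D \<inter> {..<d}. \<not> c < \<bar>X e \<omega>\<bar>)}"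
        by (force simp: A_def space_F)
    next
      fix \<omega> assume *: "\<omega> \<in> {\<omega> \<in> space (F d). c < \<bar>X d \<omega>\<bar> \<and> (\<forall>e\<in>D \<inter> {..<d}. \<not> c < \<bar>X e \<omega>\<bar>)}"
      have "S \<omega> = d" unfolding S_def
        using * D(1) that by (intro Min_eqI) (auto simp: not_less[symmetric])
      with * that show "\<omega> \<in> A \<inter> {\<omega>. S \<omega> = d}" by (auto simp: A_def space_F)
    qed
    moreover have "\<dots> \<in> sets (F d)"
    proof -
      have [measurable]: "X d \<in> borel_measurable (F d)" using X_F that by simp
      have [measurable]: "X e \<in> borel_measurable (F d)" if "e \<in> D \<inter> {..<d}" for e
        by (rule X_F) (use that in auto)
      have "{\<omega> \<in> space (F d). c < \<bar>X d \<omega>\<bar>} - (\<Union>e\<in>D \<inter> {..<d}. {\<omega> \<in> space (F d). c < \<bar>X e \<omega>\<bar>}) \<in> sets (F d)"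
        using D(1) by (intro sets.Diff sets.finite_UN) auto
      also have "{\<omega> \<in> space (F d). c < \<bar>X d \<omega>\<bar>} - (\<Union>e\<in>D \<inter> {..<d}. {\<omega> \<in> space (F d). c < \<bar>X e \<omega>\<bar>}) =
          {\<omega> \<in> space (F d). c < \<bar>X d \<omega>\<bar> \<and> (\<forall>e\<in>D \<inter> {..<d}. \<not> c < \<bar>X e \<omega>\<bar>)}"
        by blast
      finally show ?thesis .
    qed
    ultimately show ?thesis by simp
  qed
  have int_u: "integrable P (X u)" using X u by (auto simp: martingale_on_def)
  note S = martingale_at_simple_time[OF X D u, of A S, OF _ _ S_F]
  have "c * prob A = (\<integral>\<omega>. indicator A \<omega> * c \<partial>P)" by simp
  also have "\<dots> \<le> (\<integral>\<omega>. indicator A \<omega> * \<bar>X (S \<omega>) \<omega>\<bar> \<partial>P)"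
  proof (rule integral_mono)
    have "integrable P (\<lambda>\<omega>. \<bar>indicator A \<omega> * X (S \<omega>) \<omega>\<bar>)"
      using S(1) S_in by (intro integrable_abs) auto
    then show "integrable P (\<lambda>\<omega>. indicator A \<omega> * \<bar>X (S \<omega>) \<omega>\<bar>)" by (simp add: abs_mult)
    show "indicator A \<omega> * c \<le> indicator A \<omega> * \<bar>X (S \<omega>) \<omega>\<bar>" for \<omega>
      using S_in[of \<omega>] by (auto simp: indicator_def)
  qed (simp add: less_top[symmetric])
  also have "\<dots> \<le> (\<integral>\<omega>. indicator A \<omega> * \<bar>X u \<omega>\<bar> \<partial>P)"
    using S(3) S_in by auto
  also have "\<dots> \<le> (\<integral>\<omega>. \<bar>X u \<omega>\<bar> \<partial>P)"
    using int_u integrable_real_mult_indicator[OF A integrable_abs[OF int_u]]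
    by (intro integral_mono) (auto simp: indicator_def mult.commute)
  finally show ?thesis unfolding A_def .
qed

text \<open>
  Doob's inequality for \<open>\<bar>X\<bar>\<close>.  A supremum that is at least \<open>c\<close> need not be attained, but \<open>c / 2\<close> is
  exceeded at some time of a countable dense set, so the finite case applies at level \<open>c / 2\<close>.
\<close>
lemma maximal_inequality:
  assumes X: "martingale_on P F {..t} X" and rc: "right_continuous_paths P X" and c: "0 < c"
  shows "c * sup_tail P X (\<lambda>_. t) c \<le> 2 * (\<integral>\<omega>. \<bar>X t \<omega>\<bar> \<partial>P)"
proof -
  obtain D :: "ennreal set" where D: "countable D"
    "\<And>U. open U \<Longrightarrow> U \<noteq> {} \<Longrightarrow> \<exists>d\<in>D. d \<in> U"
    using countable_dense_exists by blast
  define E where "E = insert t (D \<inter> {..t})"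
  have E: "countable E" "E \<noteq> {}" "E \<subseteq> {..t}" using D(1) by (auto simp: E_def)
  define B where "B n = {\<omega> \<in> space P. \<exists>d\<in>from_nat_into E ` {..n}. c/2 < \<bar>X d \<omega>\<bar>}" for n :: nat
  have En: "from_nat_into E n \<in> E" for n by (rule from_nat_into[OF E(2)])
  have X_P: "X d \<in> borel_measurable P" if "d \<le> t" for d
    using X that measurable_from_subalg[OF subalgebra_F, of "X d" d]
    by (auto simp: martingale_on_def adapted_on_def)
  have [measurable]: "X (from_nat_into E n) \<in> borel_measurable P" for n
    using En[of n] E(3) by (intro X_P) auto
  have B[measurable]: "B n \<in> sets P" for n unfolding B_def by simp
  have "c/2 * prob (B n) \<le> (\<integral>\<omega>. \<bar>X t \<omega>\<bar> \<partial>P)" for n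
    unfolding B_def using E En c by (intro maximal_inequality_finite[OF X]) auto
  moreover have "(\<lambda>n. c/2 * prob (B n)) \<longlonglongrightarrow> c/2 * prob (\<Union>n. B n)"
    by (intro tendsto_mult_left finite_Lim_measure_incseq) (auto simp: incseq_def B_def)
  ultimately have le: "c/2 * prob (\<Union>n. B n) \<le> (\<integral>\<omega>. \<bar>X t \<omega>\<bar> \<partial>P)"
    by (intro LIMSEQ_le_const2) auto
  have "sup_tail P X (\<lambda>_. t) c \<le> prob (\<Union>n. B n)"
    unfolding sup_tail_def
  proof (rule finite_measure_mono_AE)
    show "AE \<omega> in P. \<omega> \<in> {\<omega> \<in> space P. ennreal c \<le> (SUP s\<in>{..t}. ennreal \<bar>X s \<omega>\<bar>)} \<longrightarrow> \<omega> \<in> (\<Union>n. B n)"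
      using rc unfolding right_continuous_paths_def
    proof eventually_elim
      case (elim \<omega>)
      show ?case
      proof
        assume *: "\<omega> \<in> {\<omega> \<in> space P. ennreal c \<le> (SUP s\<in>{..t}. ennreal \<bar>X s \<omega>\<bar>)}"
        have "ennreal (c/2) < ennreal c" using c by (simp add: ennreal_less_iff)
        also have "\<dots> \<le> (SUP s\<in>{..t}. ennreal \<bar>X s \<omega>\<bar>)" using * by simp
        also have "\<dots> = (SUP s\<in>E. ennreal \<bar>X s \<omega>\<bar>)"
          unfolding E_def using elim less_le_trans[of _ t \<infinity>]
          by (intro SUP_right_continuous_eq_countable D) (auto simp: top.not_eq_extremum)
        finally obtain d where "d \<in> E" "c/2 < \<bar>X d \<omega>\<bar>"
          using c by (auto simp: less_SUP_iff ennreal_less_iff)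
        moreover obtain n where "from_nat_into E n = d"
          using from_nat_into_surj[OF E(1) \<open>d \<in> E\<close>] by auto
        ultimately show "\<omega> \<in> (\<Union>n. B n)" using * by (auto simp: B_def)
      qed
    qed
  qed auto
  with c have "c/2 * sup_tail P X (\<lambda>_. t) c \<le> c/2 * prob (\<Union>n. B n)" by simp
  with le show ?thesis by simp
qed

lemma borel_measurable_running_sup:
  assumes X: "adapted_on F {..t} X" and rc: "right_continuous_paths P X"
  shows "(\<lambda>\<omega>. SUP s\<in>{..t}. ennreal \<bar>X s \<omega>\<bar>) \<in> borel_measurable P"
proof -
  obtain D :: "ennreal set" where D: "countable D"
    "\<And>U. open U \<Longrightarrow> U \<noteq> {} \<Longrightarrow> \<exists>d\<in>D. d \<in> U"
    using countable_dense_exists by blast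
  have X_P: "X d \<in> borel_measurable P" if "d \<le> t" for d
    using X that measurable_from_subalg[OF subalgebra_F, of "X d" d]
    by (auto simp: adapted_on_def)
  show ?thesis
  proof (rule measurable_if_AE_eq)
    show "(\<lambda>\<omega>. SUP s\<in>insert t (D \<inter> {..t}). ennreal \<bar>X s \<omega>\<bar>) \<in> borel_measurable P"
      using D(1) X_P by (intro borel_measurable_SUP) (auto intro!: borel_measurable_abs)
    show "AE \<omega> in P. (SUP s\<in>{..t}. ennreal \<bar>X s \<omega>\<bar>) = (SUP s\<in>insert t (D \<inter> {..t}). ennreal \<bar>X s \<omega>\<bar>)"
      using rc unfolding right_continuous_paths_def
    proof eventually_elim
      case (elim \<omega>)
      then show ?case
        using less_le_trans[of _ t \<infinity>]
        by (intro SUP_right_continuous_eq_countable D) (auto simp: top.not_eq_extremum)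
    qed
  qed auto
qed

end

section \<open>Tails and fractional moments\<close>

text \<open>
  Let \<open>Y\<close> be the supremum of \<open>\<bar>X s\<bar>\<close> over \<open>s \<in> I \<omega>\<close>.
  On \<open>{2 ^ k \<le> Y < 2 ^ (k + 1)}\<close> the power \<open>Y powr \<alpha>\<close> is at most \<open>2 powr (\<alpha> * (k + 1))\<close>, and the
  tail bound gives this event probability at most \<open>K / 2 ^ k\<close>.  The resulting series is geometric
  with ratio \<open>2 powr (\<alpha> - 1)\<close>, which is below \<open>1\<close> exactly because \<open>\<alpha> < 1\<close>.
\<close>
lemma (in prob_space) nn_integral_SUP_powr_finite:
  fixes X :: "'b \<Rightarrow> 'a \<Rightarrow> real"
  assumes \<alpha>: "0 < \<alpha>" "\<alpha> < 1"
    and Y[measurable]: "(\<lambda>\<omega>. SUP s\<in>I \<omega>. ennreal \<bar>X s \<omega>\<bar>) \<in> borel_measurable M"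
    and tail: "\<And>c. 0 < c \<Longrightarrow> c * \<P>(\<omega> in M. ennreal c \<le> (SUP s\<in>I \<omega>. ennreal \<bar>X s \<omega>\<bar>)) \<le> K"
  shows "(\<integral>\<^sup>+ \<omega>. (SUP s\<in>I \<omega>. ennreal (\<bar>X s \<omega>\<bar> powr \<alpha>)) \<partial>M) < \<infinity>"
proof -
  define B where "B k = {\<omega> \<in> space M. ennreal (2 ^ k) \<le> (SUP s\<in>I \<omega>. ennreal \<bar>X s \<omega>\<bar>)}" for k :: nat
  define a where "a k = 2 powr (\<alpha> * (real k + 1))" for k :: nat
  have B[measurable]: "B k \<in> sets M" for k unfolding B_def by measurable
  have "0 \<le> K" by (rule order_trans[OF _ tail[of 1]]) auto
  have "(SUP s\<in>I \<omega>. ennreal (\<bar>X s \<omega>\<bar> powr \<alpha>)) \<le> 1 + (\<Sum>k. ennreal (a k) * indicator (B k) \<omega>)"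
    if "\<omega> \<in> space M" for \<omega>
  proof (rule SUP_least)
    fix s assume s: "s \<in> I \<omega>"
    show "ennreal (\<bar>X s \<omega>\<bar> powr \<alpha>) \<le> 1 + (\<Sum>k. ennreal (a k) * indicator (B k) \<omega>)"
    proof (cases "\<bar>X s \<omega>\<bar> \<le> 1")
      case True
      then have "\<bar>X s \<omega>\<bar> powr \<alpha> \<le> 1" using \<alpha> by (simp add: powr_le1)
      then have "ennreal (\<bar>X s \<omega>\<bar> powr \<alpha>) \<le> 1" by simp
      then show ?thesis by (rule order_trans) simp
    next
      case False
      \<comment> \<open>\<open>2 ^ k \<le> \<bar>X s \<omega>\<bar> \<le> 2 ^ (k + 1)\<close>, so the \<open>k\<close>-th summand alone is large enough\<close>
      define k where "k = nat \<lfloor>log 2 \<bar>X s \<omega>\<bar>\<rfloor>"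
      have log: "0 \<le> log 2 \<bar>X s \<omega>\<bar>" using False by simp
      then have k: "real k \<le> log 2 \<bar>X s \<omega>\<bar>" "log 2 \<bar>X s \<omega>\<bar> \<le> real k + 1"
        unfolding k_def by linarith+
      have "2 ^ k \<le> \<bar>X s \<omega>\<bar>"
        using k(1) False by (simp add: le_log_iff powr_realpow)
      then have "ennreal (2 ^ k) \<le> ennreal \<bar>X s \<omega>\<bar>" by (rule ennreal_leI)
      also have "\<dots> \<le> (SUP s\<in>I \<omega>. ennreal \<bar>X s \<omega>\<bar>)" using s by (rule SUP_upper)
      finally have "\<omega> \<in> B k" using that by (simp add: B_def)
      have "\<bar>X s \<omega>\<bar> \<le> 2 powr (real k + 1)"
        using k(2) False by (simp add: log_le_iff)
      then have "\<bar>X s \<omega>\<bar> powr \<alpha> \<le> (2 powr (real k + 1)) powr \<alpha>"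
        using \<alpha> by (intro powr_mono2) auto
      also have "\<dots> = a k" by (simp add: a_def powr_powr mult.commute)
      finally have "ennreal (\<bar>X s \<omega>\<bar> powr \<alpha>) \<le> ennreal (a k) * indicator (B k) \<omega>"
        using \<open>\<omega> \<in> B k\<close> by (simp add: ennreal_leI)
      also have "\<dots> = (\<Sum>j\<in>{k}. ennreal (a j) * indicator (B j) \<omega>)"
        by (subst sum.insert) simp_all
      also have "\<dots> \<le> (\<Sum>j. ennreal (a j) * indicator (B j) \<omega>)"
        by (intro sum_le_suminf) auto
      finally show ?thesis by (rule order_trans) simp
    qed
  qed
  then have "(\<integral>\<^sup>+ \<omega>. (SUP s\<in>I \<omega>. ennreal (\<bar>X s \<omega>\<bar> powr \<alpha>)) \<partial>M) \<le>
      (\<integral>\<^sup>+ \<omega>. 1 + (\<Sum>k. ennreal (a k) * indicator (B k) \<omega>) \<partial>M)"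
    by (intro nn_integral_mono) auto
  also have "\<dots> = 1 + (\<Sum>k. ennreal (a k * prob (B k)))"
    by (simp add: nn_integral_add nn_integral_suminf nn_integral_cmult emeasure_space_1
        emeasure_eq_measure ennreal_mult a_def prob_space)
  also have "\<dots> \<le> 1 + (\<Sum>k. ennreal (2 powr \<alpha> * K * (2 powr (\<alpha> - 1)) ^ k))"
  proof (intro add_left_mono suminf_le ennreal_leI)
    fix k
    have "2 ^ k * prob (B k) \<le> K" unfolding B_def by (rule tail) simp
    then have "prob (B k) \<le> K / 2 ^ k" by (simp add: field_simps)
    then have "a k * prob (B k) \<le> a k * (K / 2 ^ k)" by (intro mult_left_mono) (auto simp: a_def)
    also have "\<dots> = K * 2 powr (\<alpha> + \<alpha> * real k - real k)"
      unfolding powr_diff by (simp add: a_def powr_realpow algebra_simps)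
    also have "\<dots> = 2 powr \<alpha> * K * (2 powr (\<alpha> - 1)) ^ k"
      by (simp add: powr_realpow[symmetric] powr_powr powr_add[symmetric] algebra_simps)
    finally show "a k * prob (B k) \<le> 2 powr \<alpha> * K * (2 powr (\<alpha> - 1)) ^ k" .
  qed auto
  also have "\<dots> < \<infinity>"
  proof -
    have "(2::real) powr (\<alpha> - 1) < 1" using \<alpha> powr_less_one[of 2 "\<alpha> - 1"] by auto
    then have "summable (\<lambda>k. 2 powr \<alpha> * K * (2 powr (\<alpha> - 1)) ^ k)"
      by (intro summable_mult summable_geometric) auto
    then show ?thesis using \<open>0 \<le> K\<close> by (simp add: suminf_ennreal2 )
  qed
  finally show ?thesis .
qed

text \<open>
  A finite upper limit bounds \<open>c * sup_tail M X T c\<close> for large \<open>c\<close>, and for small \<open>c\<close> it is at most \<open>c\<close>.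
  Hence it is bounded for all \<open>c\<close>, and the fractional moments are finite.
\<close>
lemma (in prob_space) Limsup_tail_eq_infinity:
  fixes X :: "ennreal \<Rightarrow> 'a \<Rightarrow> real"
  assumes \<alpha>: "0 < \<alpha>" "\<alpha> < 1"
    and Y: "(\<lambda>\<omega>. SUP s\<in>{..T \<omega>}. ennreal \<bar>X s \<omega>\<bar>) \<in> borel_measurable M"
    and inf: "expected_sup_powr M X T \<alpha> = \<infinity>"
  shows "Limsup at_top (\<lambda>c::real. ereal (c * sup_tail M X T c)) = \<infinity>"
proof (rule ccontr)
  assume "Limsup at_top (\<lambda>c::real. ereal (c * sup_tail M X T c)) \<noteq> \<infinity>"
  then obtain K :: real where "Limsup at_top (\<lambda>c::real. ereal (c * sup_tail M X T c)) < ereal K"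
    by (metis less_PInf_Ex_of_nat ereal_less_eq(1) not_le ereal_infty_less(1))
  then have "eventually (\<lambda>c. ereal (c * sup_tail M X T c) < ereal K) at_top"
    by (rule Limsup_lessD)
  then obtain C where C: "\<And>c. c \<ge> C \<Longrightarrow> c * sup_tail M X T c < K"
    by (auto simp: eventually_at_top_linorder)
  have "c * sup_tail M X T c \<le> max K C" if "0 < c" for c
  proof (cases "c \<ge> C")
    case True
    with C[OF True] show ?thesis by simp
  next
    case False
    have "sup_tail M X T c \<le> 1" unfolding sup_tail_def by (rule prob_le_1)
    with that have "c * sup_tail M X T c \<le> c" by simp
    with False show ?thesis by simp
  qed
  then have "expected_sup_powr M X T \<alpha> < \<infinity>"
    unfolding expected_sup_powr_def sup_tail_def
    by (intro nn_integral_SUP_powr_finite[OF \<alpha> Y]) auto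
  with inf show False by simp
qed

section \<open>Optional stopping\<close>

text \<open>
  The tail hypothesis is how uniform integrability arises when \<open>f n\<close> are conditional expectations of
  a single \<open>Z\<close>.  Almost sure convergence makes \<open>sup\<^sub>n \<bar>f n\<bar>\<close> finite, so the sets \<open>E C\<close> where it exceeds
  \<open>C\<close> shrink to a null set and the integral of \<open>\<bar>Z\<bar>\<close> over \<open>E C\<close>, which controls all tails at once, tends to \<open>0\<close>.
  Truncation at \<open>C\<close> then shows that the norms of \<open>f n\<close> do not exceed that of the limit
  asymptotically, and Scheffe's lemma gives convergence in \<open>L\<^sup>1\<close>.
\<close>
lemma (in finite_measure) L1_limit_of_dominated_tails:
  fixes f :: "nat \<Rightarrow> 'a \<Rightarrow> real"
  assumes int: "\<And>n. integrable M (f n)" "integrable M Z"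
    and g[measurable]: "g \<in> borel_measurable M" and lim: "AE x in M. (\<lambda>n. f n x) \<longlonglongrightarrow> g x"
    and tail: "\<And>n C. 0 \<le> C \<Longrightarrow>
      (\<integral>x. indicator {x \<in> space M. C < \<bar>f n x\<bar>} x * \<bar>f n x\<bar> \<partial>M) \<le>
      (\<integral>x. indicator {x \<in> space M. C < \<bar>f n x\<bar>} x * \<bar>Z x\<bar> \<partial>M)"
  shows "integrable M g" and "(\<lambda>n. \<integral>\<^sup>+ x. norm (f n x - g x) \<partial>M) \<longlonglongrightarrow> 0"
proof -
  have f[measurable]: "f n \<in> borel_measurable M" for n using int(1) by simp
  have Z[measurable]: "Z \<in> borel_measurable M" using int(2) by simp
  define E where "E C = {x \<in> space M. \<exists>n. real C < \<bar>f n x\<bar>}" for C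
  have E[measurable]: "E C \<in> sets M" for C unfolding E_def by measurable
  define \<epsilon> where "\<epsilon> C = (\<integral>x. indicator (E C) x * \<bar>Z x\<bar> \<partial>M)" for C
  have ind_int: "integrable M (\<lambda>x. indicator A x * \<bar>h x\<bar>)"
    if "A \<in> sets M" "integrable M h" for A and h :: "'a \<Rightarrow> real"
    using integrable_real_mult_indicator[OF that(1) integrable_abs[OF that(2)]] by (simp add: mult.commute)
  have "\<epsilon> \<longlonglongrightarrow> (\<integral>x. 0 \<partial>M)"
    unfolding \<epsilon>_def
  proof (rule integral_dominated_convergence[where w = "\<lambda>x. \<bar>Z x\<bar>"])
    show "AE x in M. (\<lambda>C. indicator (E C) x * \<bar>Z x\<bar>) \<longlonglongrightarrow> 0"
      using lim
    proof eventually_elim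
      case (elim x)
      then obtain b where b: "\<And>n. \<bar>f n x\<bar> \<le> b"
        using convergent_imp_Bseq[of "\<lambda>n. f n x"] by (auto simp: convergent_def Bseq_def)
      obtain N :: nat where N: "b \<le> real N" using real_arch_simple by blast
      have "x \<notin> E C" if "C \<ge> N" for C
        using b N that by (auto simp: E_def not_less) (meson of_nat_mono order_trans)
      then have "eventually (\<lambda>C. indicator (E C) x * \<bar>Z x\<bar> = 0) sequentially"
        by (auto simp: eventually_sequentially intro!: exI[of _ N])
      then show ?case by (rule tendsto_eventually)
    qed
  qed (use int in \<open>auto simp: indicator_def\<close>)
  then have \<epsilon>: "\<epsilon> \<longlonglongrightarrow> 0" by simp
  have nn: "(\<integral>\<^sup>+ x. ennreal \<bar>h x\<bar> \<partial>M) = ennreal (\<integral>x. \<bar>h x\<bar> \<partial>M)" if "integrable M h" for h :: "'a \<Rightarrow> real"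
    using that by (subst nn_integral_eq_integral) auto
  have bound: "(\<integral>\<^sup>+ x. norm (f n x) \<partial>M) \<le> (\<integral>\<^sup>+ x. norm (Z x) \<partial>M)" for n
  proof -
    have "(\<integral>x. \<bar>f n x\<bar> \<partial>M) = (\<integral>x. indicator {x \<in> space M. 0 < \<bar>f n x\<bar>} x * \<bar>f n x\<bar> \<partial>M)"
      by (intro Bochner_Integration.integral_cong) (auto simp: indicator_def)
    also have "\<dots> \<le> (\<integral>x. indicator {x \<in> space M. 0 < \<bar>f n x\<bar>} x * \<bar>Z x\<bar> \<partial>M)" by (rule tail) simp
    also have "\<dots> \<le> (\<integral>x. \<bar>Z x\<bar> \<partial>M)"
      using int by (intro integral_mono ind_int) (auto simp: indicator_def)
    finally show ?thesis using int by (simp add: nn ennreal_leI)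
  qed
  have "(\<integral>\<^sup>+ x. norm (g x) \<partial>M) = (\<integral>\<^sup>+ x. liminf (\<lambda>n. ennreal (norm (f n x))) \<partial>M)"
  proof (rule nn_integral_cong_AE, use lim in eventually_elim)
    case (elim x)
    then have "(\<lambda>n. ennreal (norm (f n x))) \<longlonglongrightarrow> ennreal (norm (g x))"
      by (intro tendsto_ennrealI tendsto_norm)
    then show ?case by (rule lim_imp_Liminf[OF sequentially_bot, symmetric])
  qed
  also have "\<dots> \<le> liminf (\<lambda>n. \<integral>\<^sup>+ x. ennreal (norm (f n x)) \<partial>M)"
    by (rule nn_integral_liminf) simp
  also have "\<dots> \<le> (\<integral>\<^sup>+ x. norm (Z x) \<partial>M)"
    using bound by (intro Liminf_le) auto
  also have "\<dots> < \<infinity>" using int(2) by (simp add: integrable_iff_bounded)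
  finally show g_int: "integrable M g" by (simp add: integrable_iff_bounded)
  show "(\<lambda>n. \<integral>\<^sup>+ x. norm (f n x - g x) \<partial>M) \<longlonglongrightarrow> 0"
  proof (rule Scheffe_lemma1[OF int(1) g_int lim])
    show "limsup (\<lambda>n. \<integral>\<^sup>+ x. norm (f n x) \<partial>M) \<le> (\<integral>\<^sup>+ x. norm (g x) \<partial>M)"
    proof (rule ennreal_le_epsilon)
      fix e :: real assume e: "0 < e"
      then have "eventually (\<lambda>C. \<epsilon> C < e / 2) sequentially"
        using order_tendstoD(2)[OF \<epsilon>, of "e/2"] by simp
      then obtain C where C: "\<epsilon> C < e / 2" by (auto dest: eventually_happens)
      have min_int: "integrable M (\<lambda>x. min \<bar>h x\<bar> (real C))" if "h \<in> borel_measurable M" for h :: "'a \<Rightarrow> real"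
        using that by (intro integrable_const_bound[where B = C]) auto
      have "(\<lambda>n. \<integral>x. min \<bar>f n x\<bar> (real C) \<partial>M) \<longlonglongrightarrow> (\<integral>x. min \<bar>g x\<bar> (real C) \<partial>M)"
      proof (rule integral_dominated_convergence[where w = "\<lambda>_. real C"])
        show "AE x in M. (\<lambda>n. min \<bar>f n x\<bar> (real C)) \<longlonglongrightarrow> min \<bar>g x\<bar> (real C)"
          using lim by eventually_elim (intro tendsto_min tendsto_rabs tendsto_const)
      qed auto
      moreover have "(\<integral>x. min \<bar>g x\<bar> (real C) \<partial>M) < (\<integral>x. \<bar>g x\<bar> \<partial>M) + e / 2"
        using integral_mono[OF min_int[OF g] integrable_abs[OF g_int]] e by fastforce
      ultimately have "eventually (\<lambda>n. (\<integral>x. min \<bar>f n x\<bar> (real C) \<partial>M) < (\<integral>x. \<bar>g x\<bar> \<partial>M) + e / 2) sequentially"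
        by (rule order_tendstoD(2))
      then have "eventually (\<lambda>n. (\<integral>\<^sup>+ x. norm (f n x) \<partial>M) \<le> (\<integral>\<^sup>+ x. norm (g x) \<partial>M) + ennreal e) sequentially"
      proof eventually_elim
        case (elim n)
        let ?T = "{x \<in> space M. real C < \<bar>f n x\<bar>}"
        have "(\<integral>x. \<bar>f n x\<bar> \<partial>M) \<le> (\<integral>x. min \<bar>f n x\<bar> (real C) + indicator ?T x * \<bar>f n x\<bar> \<partial>M)"
          by (intro integral_mono Bochner_Integration.integrable_add min_int ind_int integrable_abs int f)
            (auto simp: indicator_def)
        also have "\<dots> = (\<integral>x. min \<bar>f n x\<bar> (real C) \<partial>M) + (\<integral>x. indicator ?T x * \<bar>f n x\<bar> \<partial>M)"
          by (intro Bochner_Integration.integral_add min_int ind_int int f) auto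
        also have "(\<integral>x. indicator ?T x * \<bar>f n x\<bar> \<partial>M) \<le> (\<integral>x. indicator ?T x * \<bar>Z x\<bar> \<partial>M)"
          by (rule tail) simp
        also have "\<dots> \<le> \<epsilon> C"
          unfolding \<epsilon>_def using int
          by (intro integral_mono ind_int) (auto simp: indicator_def E_def)
        finally have "(\<integral>x. \<bar>f n x\<bar> \<partial>M) \<le> (\<integral>x. \<bar>g x\<bar> \<partial>M) + e"
          using elim C by simp
        then show ?case
          using int g_int e by (simp add: nn ennreal_plus[symmetric] ennreal_leI del: ennreal_plus)
      qed
      then show "limsup (\<lambda>n. \<integral>\<^sup>+ x. norm (f n x) \<partial>M) \<le> (\<integral>\<^sup>+ x. norm (g x) \<partial>M) + ennreal e"
        by (rule Limsup_bounded)
    qed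
  qed
qed

lemma right_continuous_paths_stopped:
  assumes "right_continuous_paths P X"
  shows "right_continuous_paths P (stopped X T)"
  using assms unfolding right_continuous_paths_def
proof eventually_elim
  case (elim \<omega>)
  show ?case
  proof (intro allI impI)
    fix s :: ennreal assume "s < \<infinity>"
    have "continuous (at_right s) (\<lambda>u. X (min u (T \<omega>)) \<omega>)"
    proof (cases "s < T \<omega>")
      case True
      have "((\<lambda>u. X u \<omega>) \<longlongrightarrow> X s \<omega>) (at_right s)"
        using elim \<open>s < \<infinity>\<close> by (simp add: continuous_within)
      moreover have "eventually (\<lambda>u. u < T \<omega>) (at_right s)"
        using eventually_at_right[OF True] True by blast
      then have "eventually (\<lambda>u. X u \<omega> = X (min u (T \<omega>)) \<omega>) (at_right s)"
        by eventually_elim simp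
      ultimately show ?thesis
        using True unfolding continuous_within by (simp add: Lim_transform_eventually)
    next
      case False
      have "eventually (\<lambda>u. s < u) (at_right s)"
        using eventually_at_right[OF \<open>s < \<infinity>\<close>] \<open>s < \<infinity>\<close> by blast
      then have "eventually (\<lambda>u. X (T \<omega>) \<omega> = X (min u (T \<omega>)) \<omega>) (at_right s)"
        by eventually_elim (use False in \<open>simp add: min_absorb2\<close>)
      then have "((\<lambda>u. X (min u (T \<omega>)) \<omega>) \<longlongrightarrow> X (T \<omega>) \<omega>) (at_right s)"
        by (rule tendsto_eventually[OF eventually_mono]) simp
      then show ?thesis
        using False unfolding continuous_within by (simp add: min_absorb2)
    qed
    then show "continuous (at_right s) (\<lambda>u. stopped X T u \<omega>)" by (simp add: stopped_def)
  qed
qed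

lemma right_continuous_paths_mult:
  assumes "right_continuous_paths P X"
  shows "right_continuous_paths P (\<lambda>s \<omega>. Y \<omega> * X s \<omega>)"
  using assms unfolding right_continuous_paths_def
proof eventually_elim
  case (elim \<omega>)
  show ?case
  proof (intro allI impI)
    fix s :: ennreal assume "s < \<infinity>"
    with elim have "continuous (at_right s) (\<lambda>u. X u \<omega>)" by simp
    then show "continuous (at_right s) (\<lambda>u. Y \<omega> * X u \<omega>)" by (rule continuous_mult_left)
  qed
qed

context usual_filtered_prob_space
begin

text \<open>
  Rounding up makes \<open>{next_grid_point G t (T \<omega>) = d}\<close> depend only on whether \<open>T\<close> has occurred at
  times up to \<open>d\<close>.  The hypotheses on \<open>A\<close> say that \<open>A\<close> belongs to the \<open>\<sigma>\<close>-algebra of the stopping time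
  \<open>T\<close> cut off at \<open>t\<close>.
\<close>
lemma next_grid_point_stopping_time_in_F:
  assumes G: "finite G" "t \<in> G" "G \<subseteq> {..t}" and T: "stopping_time F T"
    and A: "A \<in> sets (F t)" "\<And>d. d < t \<Longrightarrow> A \<inter> {\<omega>. T \<omega> \<le> d} \<in> sets (F d)"
    and d: "d \<in> G"
  shows "A \<inter> {\<omega>. next_grid_point G t (T \<omega>) = d} \<in> sets (F d)"
proof -
  let ?B = "A \<inter> {\<omega>. d = t \<or> T \<omega> \<le> d}"
  have "d \<le> t" using d G by auto
  have B: "?B \<in> sets (F d)"
    using A \<open>d \<le> t\<close> by (cases "d = t") auto
  have "?B - (\<Union>e\<in>G \<inter> {..<d}. {\<omega> \<in> space (F d). T \<omega> \<le> e}) \<in> sets (F d)"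
  proof (intro sets.Diff B sets.finite_UN)
    fix e assume "e \<in> G \<inter> {..<d}"
    then show "{\<omega> \<in> space (F d). T \<omega> \<le> e} \<in> sets (F d)"
      using stopping_time_le_const[OF T, of e d] by (auto simp: pred_def)
  qed (use G in auto)
  also have "?B - (\<Union>e\<in>G \<inter> {..<d}. {\<omega> \<in> space (F d). T \<omega> \<le> e}) =
      A \<inter> {\<omega>. next_grid_point G t (T \<omega>) = d}"
    unfolding next_grid_point_eq_iff[OF G d]
    using sets.sets_into_space[OF A(1)] by (auto simp: space_F not_le)
  finally show ?thesis .
qed

text \<open>
  Sampling along the grids is measurable because it is a finite sum, and right-continuity turns
  this into an almost sure limit.  This replaces progressive measurability.
\<close>
lemma measurable_stopped:
  assumes X: "adapted_on F {..t} X" and rc: "right_continuous_paths P X" and T: "stopping_time F T"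
  shows "stopped X T t \<in> borel_measurable (F t)"
proof -
  obtain G where *: "\<forall>n::nat. finite (G n) \<and> t \<in> G n \<and> G n \<subseteq> {..t}"
    "\<forall>r b. r < b \<and> b \<le> t \<longrightarrow> (\<exists>N. \<forall>n\<ge>N. \<exists>d\<in>G n. r < d \<and> d < b)"
    using dense_grids[of t] by (elim exE conjE) (rule that)
  then have G: "\<And>n. finite (G n)" "\<And>n. t \<in> G n" "\<And>n. G n \<subseteq> {..t}"
    and dense: "\<And>r b. r < b \<Longrightarrow> b \<le> t \<Longrightarrow> \<exists>N. \<forall>n\<ge>N. \<exists>d\<in>G n. r < d \<and> d < b"
    by simp_all
  let ?S = "\<lambda>n \<omega>. next_grid_point (G n) t (T \<omega>)"
  have X_F: "X d \<in> borel_measurable (F t)" if "d \<le> t" for d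
    using X that by (intro measurable_F_mono[OF _ that]) (auto simp: adapted_on_def)
  have S_F: "space P \<inter> {\<omega>. ?S n \<omega> = d} \<in> sets (F d)" if "d \<in> G n" for n d
  proof (rule next_grid_point_stopping_time_in_F[OF G T _ _ that])
    show "space P \<in> sets (F t)" using sets.top[of "F t"] by (simp add: space_F)
    show "space P \<inter> {\<omega>. T \<omega> \<le> e} \<in> sets (F e)" for e
      using stopping_timeD[OF T, of e] by (simp add: pred_def space_F Int_def)
  qed
  have meas: "(\<lambda>\<omega>. X (?S n \<omega>) \<omega>) \<in> borel_measurable (F t)" for n
  proof -
    have "(\<lambda>\<omega>. \<Sum>d\<in>G n. indicator (space P \<inter> {\<omega>. ?S n \<omega> = d}) \<omega> * X d \<omega>) \<in> borel_measurable (F t)"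
    proof (intro borel_measurable_sum borel_measurable_times borel_measurable_indicator)
      fix d assume d: "d \<in> G n"
      then have "d \<le> t" using G(3)[of n] by auto
      then show "X d \<in> borel_measurable (F t)" by (rule X_F)
      show "space P \<inter> {\<omega>. ?S n \<omega> = d} \<in> sets (F t)"
        using S_F[OF d] sets_F_mono[OF \<open>d \<le> t\<close>] by blast
    qed
    also have "?this \<longleftrightarrow> ?thesis"
    proof (rule measurable_cong)
      fix \<omega> assume "\<omega> \<in> space (F t)"
      then have "(\<Sum>d\<in>G n. indicator (space P \<inter> {\<omega>. ?S n \<omega> = d}) \<omega> * X d \<omega>) =
          (\<Sum>d\<in>G n. if d = ?S n \<omega> then X d \<omega> else 0)"
        by (intro sum.cong) (auto simp: indicator_def space_F)
      also have "\<dots> = X (?S n \<omega>) \<omega>"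
        using next_grid_point_in[OF G, of n "T \<omega>"] G(1) by simp
      finally show "(\<Sum>d\<in>G n. indicator (space P \<inter> {\<omega>. ?S n \<omega> = d}) \<omega> * X d \<omega>) = X (?S n \<omega>) \<omega>" .
    qed
    finally show ?thesis .
  qed
  show ?thesis
  proof (rule measurable_if_AE_eq)
    show "(\<lambda>\<omega>. lim (\<lambda>n. X (?S n \<omega>) \<omega>)) \<in> borel_measurable (F t)"
      by (rule borel_measurable_lim_metric) (rule meas)
    show "AE \<omega> in P. stopped X T t \<omega> = lim (\<lambda>n. X (?S n \<omega>) \<omega>)"
      using rc unfolding right_continuous_paths_def
    proof eventually_elim
      case (elim \<omega>)
      have "(\<lambda>n. X (?S n \<omega>) \<omega>) \<longlonglongrightarrow> X (min (T \<omega>) t) \<omega>"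
        using elim less_le_trans[of _ t \<infinity>]
        by (intro next_grid_point_path_tendsto[OF G dense]) (auto simp: top.not_eq_extremum)
      then show ?case by (simp add: stopped_def limI min.commute)
    qed
  qed (use space_F null_sets_subset_F in auto)
qed

lemma adapted_on_stopped:
  assumes "adapted_on F I X" "\<And>t. t \<in> I \<Longrightarrow> {..t} \<subseteq> I"
    and "right_continuous_paths P X" "stopping_time F T"
  shows "adapted_on F I (stopped X T)"
  unfolding adapted_on_def
proof
  fix t assume "t \<in> I"
  then have "adapted_on F {..t} X"
    using assms(1,2) unfolding adapted_on_def by blast
  then show "stopped X T t \<in> borel_measurable (F t)"
    using assms(3,4) by (rule measurable_stopped)
qed

text \<open>
  The values of \<open>X\<close> at the rounded times have tails dominated by those of \<open>X t\<close>, by sampling at simple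
  times on the event that they are large.  So they converge in \<open>L\<^sup>1\<close> along the grids, and the
  sampling identity for simple times passes to the limit.
\<close>
lemma optional_sampling:
  assumes X: "martingale_on P F {..t} X" and rc: "right_continuous_paths P X" and T: "stopping_time F T"
  shows "integrable P (stopped X T t)"
    and "A \<in> sets (F t) \<Longrightarrow> (\<And>d. d < t \<Longrightarrow> A \<inter> {\<omega>. T \<omega> \<le> d} \<in> sets (F d)) \<Longrightarrow>
      (\<integral>\<omega>. indicator A \<omega> * stopped X T t \<omega> \<partial>P) = (\<integral>\<omega>. indicator A \<omega> * X t \<omega> \<partial>P)"
proof -
  obtain G where *: "\<forall>n::nat. finite (G n) \<and> t \<in> G n \<and> G n \<subseteq> {..t}"
    "\<forall>r b. r < b \<and> b \<le> t \<longrightarrow> (\<exists>N. \<forall>n\<ge>N. \<exists>d\<in>G n. r < d \<and> d < b)"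
    using dense_grids[of t] by (elim exE conjE) (rule that)
  then have G: "\<And>n. finite (G n)" "\<And>n. t \<in> G n" "\<And>n. G n \<subseteq> {..t}"
    and dense: "\<And>r b. r < b \<Longrightarrow> b \<le> t \<Longrightarrow> \<exists>N. \<forall>n\<ge>N. \<exists>d\<in>G n. r < d \<and> d < b"
    by simp_all
  let ?S = "\<lambda>n \<omega>. next_grid_point (G n) t (T \<omega>)"
  define f where "f n \<omega> = X (?S n \<omega>) \<omega>" for n \<omega>
  have int_t: "integrable P (X t)" using X by (simp add: martingale_on_integrable)
  have space: "space P \<in> sets (F t)" "space P \<inter> {\<omega>. T \<omega> \<le> d} \<in> sets (F d)" for d
    using sets.top[of "F t"] stopping_timeD[OF T, of d] by (simp_all add: pred_def space_F Int_def)
  have le: "d \<le> t" if "d \<in> G n" for d n using that G(3)[of n] by auto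
  have S_in: "?S n \<omega> \<in> G n" for n \<omega> by (rule next_grid_point_in[OF G])
  have sampled:
      "integrable P (\<lambda>\<omega>. indicator A \<omega> * X (?S n \<omega>) \<omega>)"
      "(\<integral>\<omega>. indicator A \<omega> * X (?S n \<omega>) \<omega> \<partial>P) = (\<integral>\<omega>. indicator A \<omega> * X t \<omega> \<partial>P)"
      "(\<integral>\<omega>. indicator A \<omega> * \<bar>X (?S n \<omega>) \<omega>\<bar> \<partial>P) \<le> (\<integral>\<omega>. indicator A \<omega> * \<bar>X t \<omega>\<bar> \<partial>P)"
    if "\<And>d. d \<in> G n \<Longrightarrow> A \<inter> {\<omega>. ?S n \<omega> = d} \<in> sets (F d)" for A n
  proof -
    note * = martingale_at_simple_time[where S = "?S n" and A = A and u = t, OF X G(1) G(3)]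
    show "integrable P (\<lambda>\<omega>. indicator A \<omega> * X (?S n \<omega>) \<omega>)"
      by (rule *(1)) (use le S_in that in simp_all)
    show "(\<integral>\<omega>. indicator A \<omega> * X (?S n \<omega>) \<omega> \<partial>P) = (\<integral>\<omega>. indicator A \<omega> * X t \<omega> \<partial>P)"
      by (rule *(2)) (use le S_in that in simp_all)
    show "(\<integral>\<omega>. indicator A \<omega> * \<bar>X (?S n \<omega>) \<omega>\<bar> \<partial>P) \<le> (\<integral>\<omega>. indicator A \<omega> * \<bar>X t \<omega>\<bar> \<partial>P)"
      by (rule *(3)) (use le S_in that in simp_all)
  qed
  have sampled_F: "A \<inter> {\<omega>. ?S n \<omega> = d} \<in> sets (F d)"
    if "A \<in> sets (F t)" "\<And>d. d < t \<Longrightarrow> A \<inter> {\<omega>. T \<omega> \<le> d} \<in> sets (F d)" "d \<in> G n" for A n d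
    using that by (intro next_grid_point_stopping_time_in_F[OF G T])
  have int_f: "integrable P (f n)" for n
  proof -
    have "integrable P (\<lambda>\<omega>. indicator (space P) \<omega> * f n \<omega>)"
      unfolding f_def by (rule sampled(1)[OF sampled_F]) (auto intro: space)
    also have "?this \<longleftrightarrow> ?thesis" by (rule Bochner_Integration.integrable_cong) auto
    finally show ?thesis .
  qed
  have lim: "AE \<omega> in P. (\<lambda>n. f n \<omega>) \<longlonglongrightarrow> stopped X T t \<omega>"
    using rc unfolding right_continuous_paths_def
  proof eventually_elim
    case (elim \<omega>)
    have "(\<lambda>n. X (?S n \<omega>) \<omega>) \<longlonglongrightarrow> X (min (T \<omega>) t) \<omega>"
      using elim less_le_trans[of _ t \<infinity>]
      by (intro next_grid_point_path_tendsto[OF G dense]) (auto simp: top.not_eq_extremum)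
    then show ?case by (simp add: stopped_def f_def min.commute)
  qed
  have X_F: "X d \<in> borel_measurable (F d)" if "d \<le> t" for d
    using X that by (simp add: martingale_on_measurable)
  have "stopped X T t \<in> borel_measurable (F t)"
    using X rc T by (intro measurable_stopped) (auto simp: martingale_on_def)
  then have [measurable]: "stopped X T t \<in> borel_measurable P"
    by (rule measurable_from_subalg[OF subalgebra_F])
  have tail: "(\<integral>\<omega>. indicator {\<omega> \<in> space P. C < \<bar>f n \<omega>\<bar>} \<omega> * \<bar>f n \<omega>\<bar> \<partial>P) \<le>
      (\<integral>\<omega>. indicator {\<omega> \<in> space P. C < \<bar>f n \<omega>\<bar>} \<omega> * \<bar>X t \<omega>\<bar> \<partial>P)" for n C
    unfolding f_def
  proof (rule sampled(3))
    fix d assume d: "d \<in> G n"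
    have [measurable]: "X d \<in> borel_measurable (F d)" by (rule X_F[OF le[OF d]])
    have "{\<omega> \<in> space P. C < \<bar>X (?S n \<omega>) \<omega>\<bar>} \<inter> {\<omega>. ?S n \<omega> = d} =
        {\<omega> \<in> space (F d). C < \<bar>X d \<omega>\<bar>} \<inter> (space P \<inter> {\<omega>. ?S n \<omega> = d})"
      by (auto simp: space_F)
    also have "\<dots> \<in> sets (F d)"
      by (intro sets.Int sampled_F space d) measurable
    finally show "{\<omega> \<in> space P. C < \<bar>X (?S n \<omega>) \<omega>\<bar>} \<inter> {\<omega>. ?S n \<omega> = d} \<in> sets (F d)" .
  qed
  show int: "integrable P (stopped X T t)"
    by (rule L1_limit_of_dominated_tails(1)[OF int_f int_t _ lim tail]) simp
  have L1: "(\<lambda>n. \<integral>\<^sup>+ \<omega>. norm (f n \<omega> - stopped X T t \<omega>) \<partial>P) \<longlonglongrightarrow> 0"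
    by (rule L1_limit_of_dominated_tails(2)[OF int_f int_t _ lim tail]) simp
  assume A: "A \<in> sets (F t)" "\<And>d. d < t \<Longrightarrow> A \<inter> {\<omega>. T \<omega> \<le> d} \<in> sets (F d)"
  have A_P: "A \<in> sets P" using A(1) sets_F_subset by auto
  have ind_int: "integrable P (\<lambda>\<omega>. indicator A \<omega> * h \<omega>)" if "integrable P h" for h :: "'a \<Rightarrow> real"
    using integrable_real_mult_indicator[OF A_P that] by (simp add: mult.commute)
  have "(\<lambda>n. \<integral>\<omega>. indicator A \<omega> * f n \<omega> \<partial>P) \<longlonglongrightarrow> (\<integral>\<omega>. indicator A \<omega> * stopped X T t \<omega> \<partial>P)"
  proof (rule tendsto_L1_int)
    show "(\<lambda>n. \<integral>\<^sup>+ \<omega>. norm (indicator A \<omega> * f n \<omega> - indicator A \<omega> * stopped X T t \<omega>) \<partial>P) \<longlonglongrightarrow> 0"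
      by (rule tendsto_sandwich[OF _ _ tendsto_const L1])
        (auto intro!: always_eventually nn_integral_mono simp: indicator_def)
  qed (auto intro!: ind_int int_f int)
  moreover have "(\<integral>\<omega>. indicator A \<omega> * f n \<omega> \<partial>P) = (\<integral>\<omega>. indicator A \<omega> * X t \<omega> \<partial>P)" for n
    unfolding f_def by (rule sampled(2)[OF sampled_F[OF A]])
  ultimately show "(\<integral>\<omega>. indicator A \<omega> * stopped X T t \<omega> \<partial>P) = (\<integral>\<omega>. indicator A \<omega> * X t \<omega> \<partial>P)"
    by (simp add: LIMSEQ_const_iff)
qed

lemma martingale_onI:
  assumes ad: "adapted_on F I X" and int: "\<And>s. s \<in> I \<Longrightarrow> integrable P (X s)"
    and eq: "\<And>s u A. s \<in> I \<Longrightarrow> u \<in> I \<Longrightarrow> s \<le> u \<Longrightarrow> A \<in> sets (F s) \<Longrightarrow>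
      (\<integral>\<omega>. indicator A \<omega> * X u \<omega> \<partial>P) = (\<integral>\<omega>. indicator A \<omega> * X s \<omega> \<partial>P)"
  shows "martingale_on P F I X"
  unfolding martingale_on_def
proof (intro conjI ballI impI ad int)
  fix s u assume su: "s \<in> I" "u \<in> I" "s \<le> u"
  interpret S: finite_measure_subalgebra P "F s"
    by standard (rule subalgebra_F)
  show "AE \<omega> in P. real_cond_exp P (F s) (X u) \<omega> = X s \<omega>"
  proof (rule S.real_cond_exp_charact)
    show "set_lebesgue_integral P A (X u) = set_lebesgue_integral P A (X s)" if "A \<in> sets (F s)" for A
      using eq[OF su that] by (simp add: set_lebesgue_integral_def)
  qed (use ad int su in \<open>auto simp: adapted_on_def\<close>)
qed

lemma martingale_on_subset: "martingale_on P F I X \<Longrightarrow> J \<subseteq> I \<Longrightarrow> martingale_on P F J X"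
  by (simp add: martingale_on_def adapted_on_def subset_eq)

text \<open>
  For \<open>A \<in> F s\<close> the part where \<open>T \<le> s\<close> is trivial, since the stopped process no longer moves there.
  On the remaining part \<open>B\<close> the stopped values at \<open>u\<close> and \<open>s\<close> have the same integrals as \<open>X u\<close> and
  \<open>X s\<close> by optional sampling, which applies because
  \<open>B \<inter> {T \<le> d}\<close> is empty for \<open>d < s\<close> and lies in \<open>F d\<close> otherwise.
\<close>
lemma martingale_on_stopped:
  assumes X: "martingale_on P F I X" and I: "\<And>t. t \<in> I \<Longrightarrow> {..t} \<subseteq> I"
    and rc: "right_continuous_paths P X" and T: "stopping_time F T"
  shows "martingale_on P F I (stopped X T)"
proof (rule martingale_onI)
  show "adapted_on F I (stopped X T)"
    using X I rc T by (intro adapted_on_stopped) (auto simp: martingale_on_def)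
  have X_t: "martingale_on P F {..t} X" if "t \<in> I" for t
    by (rule martingale_on_subset[OF X I[OF that]])
  show int: "integrable P (stopped X T s)" if "s \<in> I" for s
    by (rule optional_sampling[OF X_t[OF that] rc T])
  fix s u A assume su: "s \<in> I" "u \<in> I" "s \<le> u" and A: "A \<in> sets (F s)"
  let ?B = "A \<inter> {\<omega> \<in> space (F s). \<not> T \<omega> \<le> s}" and ?C = "A \<inter> {\<omega> \<in> space (F s). T \<omega> \<le> s}"
  have T_s: "{\<omega> \<in> space (F s). T \<omega> \<le> s} \<in> sets (F s)"
    using stopping_timeD[OF T, of s] by (simp add: pred_def)
  have B: "?B \<in> sets (F s)" and C: "?C \<in> sets (F s)"
  proof -
    have "?B = A - {\<omega> \<in> space (F s). T \<omega> \<le> s}" using sets.sets_into_space[OF A] by blast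
    with A T_s show "?B \<in> sets (F s)" "?C \<in> sets (F s)" by simp_all
  qed
  have B_T: "?B \<inter> {\<omega>. T \<omega> \<le> d} \<in> sets (F d)" for d
  proof (cases "s \<le> d")
    case True
    then have "?B \<in> sets (F d)" "{\<omega> \<in> space (F d). T \<omega> \<le> d} \<in> sets (F d)"
      using B sets_F_mono[of s d] stopping_timeD[OF T, of d] by (auto simp: pred_def)
    then have "?B \<inter> {\<omega> \<in> space (F d). T \<omega> \<le> d} \<in> sets (F d)" by (rule sets.Int)
    also have "?B \<inter> {\<omega> \<in> space (F d). T \<omega> \<le> d} = ?B \<inter> {\<omega>. T \<omega> \<le> d}" by (auto simp: space_F)
    finally show ?thesis .
  next
    case False
    then have "?B \<inter> {\<omega>. T \<omega> \<le> d} = {}" by auto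
    then show ?thesis by simp
  qed
  have B_u: "?B \<in> sets (F u)" using B sets_F_mono[OF su(3)] by blast
  have ind_int: "integrable P (\<lambda>\<omega>. indicator D \<omega> * stopped X T v \<omega>)"
    if "D \<in> sets (F s)" "v \<in> I" for D v
    using integrable_real_mult_indicator[of D P "stopped X T v"] that int sets_F_subset[of s]
    by (auto simp: mult.commute)
  have split: "(\<integral>\<omega>. indicator A \<omega> * stopped X T v \<omega> \<partial>P) =
      (\<integral>\<omega>. indicator ?B \<omega> * stopped X T v \<omega> \<partial>P) + (\<integral>\<omega>. indicator ?C \<omega> * stopped X T v \<omega> \<partial>P)"
    if "v \<in> I" for v
  proof -
    have "(\<integral>\<omega>. indicator A \<omega> * stopped X T v \<omega> \<partial>P) =
        (\<integral>\<omega>. indicator ?B \<omega> * stopped X T v \<omega> + indicator ?C \<omega> * stopped X T v \<omega> \<partial>P)"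
      by (intro Bochner_Integration.integral_cong) (auto simp: indicator_def space_F)
    then show ?thesis using ind_int[OF B that] ind_int[OF C that] by simp
  qed
  have "(\<integral>\<omega>. indicator ?B \<omega> * stopped X T u \<omega> \<partial>P) = (\<integral>\<omega>. indicator ?B \<omega> * X u \<omega> \<partial>P)"
    by (rule optional_sampling(2)[OF X_t[OF su(2)] rc T B_u B_T])
  also have "\<dots> = (\<integral>\<omega>. indicator ?B \<omega> * X s \<omega> \<partial>P)"
    by (rule set_integral_martingale[OF X su B, symmetric])
  also have "\<dots> = (\<integral>\<omega>. indicator ?B \<omega> * stopped X T s \<omega> \<partial>P)"
    by (rule optional_sampling(2)[OF X_t[OF su(1)] rc T B B_T, symmetric])
  finally have on_B: "(\<integral>\<omega>. indicator ?B \<omega> * stopped X T u \<omega> \<partial>P) = (\<integral>\<omega>. indicator ?B \<omega> * stopped X T s \<omega> \<partial>P)" .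
  have "(\<integral>\<omega>. indicator ?C \<omega> * stopped X T u \<omega> \<partial>P) = (\<integral>\<omega>. indicator ?C \<omega> * stopped X T s \<omega> \<partial>P)"
    using su(3) by (intro Bochner_Integration.integral_cong)
      (auto simp: indicator_def stopped_def min_absorb2)
  with on_B show "(\<integral>\<omega>. indicator A \<omega> * stopped X T u \<omega> \<partial>P) = (\<integral>\<omega>. indicator A \<omega> * stopped X T s \<omega> \<partial>P)"
    unfolding split[OF su(1)] split[OF su(2)] by simp
qed

section \<open>Local martingales\<close>

lemma local_martingale_on_subset:
  "local_martingale_on P F I X \<Longrightarrow> J \<subseteq> I \<Longrightarrow> local_martingale_on P F J X"
  unfolding local_martingale_on_def adapted_on_def by (blast intro: martingale_on_subset)

text \<open>
  Stopping at \<open>T\<close> and at \<open>\<tau> n\<close> commute, so the localizing sequence of \<open>X\<close> also serves the stopped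
  process.
\<close>
lemma local_martingale_on_stopped:
  assumes X: "local_martingale_on P F I X" and I: "\<And>t. t \<in> I \<Longrightarrow> {..t} \<subseteq> I"
    and rc: "right_continuous_paths P X" and T: "stopping_time F T"
  shows "local_martingale_on P F I (stopped X T)"
proof -
  obtain \<tau> where \<tau>: "\<And>n. stopping_time F (\<tau> n)"
      "AE \<omega> in P. incseq (\<lambda>n. \<tau> n \<omega>) \<and> (\<lambda>n. \<tau> n \<omega>) \<longlonglongrightarrow> \<infinity>"
    and m: "\<And>n. martingale_on P F I (\<lambda>s \<omega>. indicator {\<omega>. 0 < \<tau> n \<omega>} \<omega> * stopped X (\<tau> n) s \<omega>)"
      (is "\<And>n. martingale_on P F I (?Y n)")
    and ad: "adapted_on F I X"
    using X unfolding local_martingale_on_def by blast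
  have "martingale_on P F I (stopped (?Y n) T)" for n
    by (intro martingale_on_stopped[OF m I _ T] right_continuous_paths_mult
        right_continuous_paths_stopped rc)
  also have "stopped (?Y n) T =
      (\<lambda>s \<omega>. indicator {\<omega>. 0 < \<tau> n \<omega>} \<omega> * stopped (stopped X T) (\<tau> n) s \<omega>)" for n
    by (intro ext) (simp add: stopped_def min.assoc min.commute min.left_commute)
  finally show ?thesis
    unfolding local_martingale_on_def
    using \<tau> adapted_on_stopped[OF ad I rc T] by blast
qed

text \<open>
  The maximal inequality bounds \<open>c * sup_tail P X (\<lambda>_. t) c\<close> for a martingale, whereas the infinite
  moment makes it unbounded.  The time \<open>t\<close> may be \<open>\<infinity>\<close>, which covers all the cases of the theorem.
\<close>
lemma strict_local_martingale_if_moment_infinite: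
  assumes X: "local_martingale_on P F {..t} X" and rc: "right_continuous_paths P X"
    and \<alpha>: "0 < \<alpha>" "\<alpha> < 1" and inf: "expected_sup_powr P X (\<lambda>_. t) \<alpha> = \<infinity>"
  shows "strict_local_martingale_on P F {..t} X"
    and "Limsup at_top (\<lambda>c::real. ereal (c * sup_tail P X (\<lambda>_. t) c)) = \<infinity>"
proof -
  have "(\<lambda>\<omega>. SUP s\<in>{..t}. ennreal \<bar>X s \<omega>\<bar>) \<in> borel_measurable P"
    using X rc by (intro borel_measurable_running_sup) (auto simp: local_martingale_on_def)
  then show Limsup: "Limsup at_top (\<lambda>c::real. ereal (c * sup_tail P X (\<lambda>_. t) c)) = \<infinity>"
    by (rule Limsup_tail_eq_infinity[OF \<alpha> _ inf])
  have "\<not> martingale_on P F {..t} X"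
  proof
    assume "martingale_on P F {..t} X"
    from maximal_inequality[OF this rc]
    have "eventually (\<lambda>c. ereal (c * sup_tail P X (\<lambda>_. t) c) \<le> ereal (2 * (\<integral>\<omega>. \<bar>X t \<omega>\<bar> \<partial>P))) at_top"
      by (auto intro: eventually_mono[OF eventually_gt_at_top[of 0]])
    then have "Limsup at_top (\<lambda>c::real. ereal (c * sup_tail P X (\<lambda>_. t) c)) \<le> ereal (2 * (\<integral>\<omega>. \<bar>X t \<omega>\<bar> \<partial>P))"
      by (rule Limsup_bounded)
    with Limsup show False by simp
  qed
  with X show "strict_local_martingale_on P F {..t} X"
    by (simp add: strict_local_martingale_on_def)
qed

lemma SUP_stopped:
  fixes f :: "real \<Rightarrow> ennreal"
  assumes "T \<omega> \<le> t"
  shows "(SUP s\<in>{..t}. f (stopped X T s \<omega>)) = (SUP s\<in>{..T \<omega>}. f (X s \<omega>))"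
proof -
  have "(\<lambda>s. min s (T \<omega>)) ` {..t} = {..T \<omega>}"
    using assms by (auto simp: image_iff min_def intro!: bexI[of _ "_ :: ennreal"])
  then have "(SUP s\<in>{..T \<omega>}. f (X s \<omega>)) = (SUP s\<in>(\<lambda>s. min s (T \<omega>)) ` {..t}. f (X s \<omega>))" by simp
  then show ?thesis by (simp add: stopped_def image_image)
qed

lemma
  assumes T: "AE \<omega> in P. T \<omega> \<le> t"
  shows expected_sup_powr_stopped:
      "expected_sup_powr P (stopped X T) (\<lambda>_. t) \<alpha> = expected_sup_powr P X T \<alpha>"
    and sup_tail_stopped:
      "adapted_on F {..t} (stopped X T) \<Longrightarrow> right_continuous_paths P (stopped X T) \<Longrightarrow>
        sup_tail P (stopped X T) (\<lambda>_. t) c = sup_tail P X T c"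
proof -
  show "expected_sup_powr P (stopped X T) (\<lambda>_. t) \<alpha> = expected_sup_powr P X T \<alpha>"
    unfolding expected_sup_powr_def
    by (rule nn_integral_cong_AE, use T in eventually_elim)
      (rule SUP_stopped[where f = "\<lambda>x. ennreal (\<bar>x\<bar> powr \<alpha>)"])
  assume "adapted_on F {..t} (stopped X T)" "right_continuous_paths P (stopped X T)"
  then have m1: "(\<lambda>\<omega>. SUP s\<in>{..t}. ennreal \<bar>stopped X T s \<omega>\<bar>) \<in> borel_measurable P"
    by (rule borel_measurable_running_sup)
  have ae: "AE \<omega> in P. (SUP s\<in>{..T \<omega>}. ennreal \<bar>X s \<omega>\<bar>) = (SUP s\<in>{..t}. ennreal \<bar>stopped X T s \<omega>\<bar>)"
    using T by eventually_elim (rule SUP_stopped[where f = "\<lambda>x. ennreal \<bar>x\<bar>", symmetric])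
  have m2: "(\<lambda>\<omega>. SUP s\<in>{..T \<omega>}. ennreal \<bar>X s \<omega>\<bar>) \<in> borel_measurable P"
    by (rule measurable_if_AE_eq[OF _ _ m1 ae]) auto
  note [measurable] = m1 m2
  show "sup_tail P (stopped X T) (\<lambda>_. t) c = sup_tail P X T c"
    unfolding sup_tail_def using ae by (intro measure_eq_AE) auto
qed

section \<open>Closing a process at infinity\<close>

lemma right_continuous_paths_closed_at_infinity:
  assumes "right_continuous_paths P X"
  shows "right_continuous_paths P (closed_at_infinity X)"
  using assms unfolding right_continuous_paths_def
proof eventually_elim
  case (elim \<omega>)
  show ?case
  proof (intro allI impI)
    fix s :: ennreal assume s: "s < \<infinity>"
    have "eventually (\<lambda>u. u < \<infinity>) (at_right s)"
      using eventually_at_right[OF s] s by blast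
    then have "eventually (\<lambda>u. X u \<omega> = closed_at_infinity X u \<omega>) (at_right s)"
      by eventually_elim (auto simp: closed_at_infinity_def)
    moreover have "((\<lambda>u. X u \<omega>) \<longlongrightarrow> X s \<omega>) (at_right s)"
      using elim s by (simp add: continuous_within)
    ultimately have "((\<lambda>u. closed_at_infinity X u \<omega>) \<longlongrightarrow> X s \<omega>) (at_right s)"
      by (rule Lim_transform_eventually[rotated])
    moreover have "closed_at_infinity X s \<omega> = X s \<omega>"
      using s by (auto simp: closed_at_infinity_def)
    ultimately show "continuous (at_right s) (\<lambda>u. closed_at_infinity X u \<omega>)"
      by (simp only: continuous_within)
  qed
qed

text \<open>
  The value at \<open>\<infinity>\<close> is almost surely the limit along the integers.  Where the limit fails to exist,
  \<open>Lim\<close> is an unspecified value, but this happens on a null set only.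
\<close>
lemma adapted_on_closed_at_infinity:
  assumes X: "adapted_on F {..<\<infinity>} X" and lim: "has_limit_at_infinity P X"
  shows "adapted_on F {..\<infinity>} (closed_at_infinity X)"
  unfolding adapted_on_def
proof
  fix s :: ennreal assume "s \<in> {..\<infinity>}"
  show "closed_at_infinity X s \<in> borel_measurable (F s)"
  proof (cases "s = \<infinity>")
    case False
    then have "closed_at_infinity X s = X s" by (auto simp: closed_at_infinity_def)
    with X False show ?thesis by (simp add: adapted_on_def less_top)
  next
    case True
    have X_F: "X (ennreal (real n)) \<in> borel_measurable (F \<infinity>)" for n
      using X by (intro measurable_F_mono[of _ "ennreal (real n)" \<infinity>]) (auto simp: adapted_on_def)
    have "closed_at_infinity X \<infinity> \<in> borel_measurable (F \<infinity>)"
    proof (rule measurable_if_AE_eq)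
      show "(\<lambda>\<omega>. lim (\<lambda>n. X (ennreal (real n)) \<omega>)) \<in> borel_measurable (F \<infinity>)"
        by (rule borel_measurable_lim_metric) (rule X_F)
      show "AE \<omega> in P. closed_at_infinity X \<infinity> \<omega> = lim (\<lambda>n. X (ennreal (real n)) \<omega>)"
        using lim unfolding has_limit_at_infinity_def
      proof eventually_elim
        case (elim \<omega>)
        then obtain l where l: "((\<lambda>r::real. X (ennreal r) \<omega>) \<longlongrightarrow> l) at_top" by blast
        then have "(\<lambda>n. X (ennreal (real n)) \<omega>) \<longlonglongrightarrow> l"
          by (rule filterlim_compose[OF _ filterlim_real_sequentially])
        with l show ?case
          by (simp add: closed_at_infinity_def limI tendsto_Lim)
      qed
    qed (use space_F null_sets_subset_F in auto)
    with True show ?thesis by simp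
  qed
qed

text \<open>
  A martingale on \<open>[0,\<infinity>)\<close> stopped at a deterministic time \<open>N\<close> is constant from \<open>N\<close> on and therefore
  trivially extends to a martingale on \<open>[0,\<infinity>]\<close>.  So it suffices to cut off the localizing times
  at deterministic times tending to \<open>\<infinity>\<close>; the limit of \<open>X\<close> never enters the stopped processes.
  The cut-off at \<open>Suc n\<close> instead of \<open>n\<close> keeps the event \<open>{0 < \<tau> n}\<close> unchanged.
\<close>
lemma local_martingale_on_closed_at_infinity:
  assumes X: "local_martingale_on P F {..<\<infinity>} X" and lim: "has_limit_at_infinity P X"
  shows "local_martingale_on P F {..\<infinity>} (closed_at_infinity X)"
proof -
  obtain \<tau> where \<tau>: "\<And>n. stopping_time F (\<tau> n)"
      "AE \<omega> in P. incseq (\<lambda>n. \<tau> n \<omega>) \<and> (\<lambda>n. \<tau> n \<omega>) \<longlonglongrightarrow> \<infinity>"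
    and m: "\<And>n. martingale_on P F {..<\<infinity>} (\<lambda>s \<omega>. indicator {\<omega>. 0 < \<tau> n \<omega>} \<omega> * stopped X (\<tau> n) s \<omega>)"
      (is "\<And>n. martingale_on P F _ (?Y n)")
    and ad: "adapted_on F {..<\<infinity>} X"
    using X unfolding local_martingale_on_def by blast
  define \<sigma> where "\<sigma> n \<omega> = min (\<tau> n \<omega>) (of_nat (Suc n))" for n \<omega>
  have \<sigma>_st: "stopping_time F (\<sigma> n)" for n
    unfolding \<sigma>_def by (intro stopping_time_min \<tau> stopping_time_const)
  have \<sigma>_lim: "AE \<omega> in P. incseq (\<lambda>n. \<sigma> n \<omega>) \<and> (\<lambda>n. \<sigma> n \<omega>) \<longlonglongrightarrow> \<infinity>"
    using \<tau>(2)
  proof eventually_elim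
    case (elim \<omega>)
    have "(\<lambda>n. of_nat (Suc n) :: ennreal) \<longlonglongrightarrow> \<infinity>"
      using LIMSEQ_Suc[OF of_nat_tendsto_top_ennreal] by simp
    then have "(\<lambda>n. min (\<tau> n \<omega>) (of_nat (Suc n))) \<longlonglongrightarrow> min \<infinity> \<infinity>"
      using elim by (intro tendsto_min) auto
    moreover have "incseq (\<lambda>n. min (\<tau> n \<omega>) (of_nat (Suc n)))"
      using elim by (auto simp: incseq_def intro: min.coboundedI1 min.coboundedI2 add_left_mono)
    ultimately show ?case by (simp add: \<sigma>_def)
  qed
  have "martingale_on P F {..\<infinity>} (\<lambda>s \<omega>. ?Y n (min s (of_nat (Suc n))) \<omega>)" for n
  proof (rule martingale_onI)
    let ?N = "of_nat (Suc n) :: ennreal"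
    have N: "?N < \<infinity>" "min s ?N < \<infinity>" for s using of_nat_less_top[of "Suc n"] by (simp_all add: min_less_iff_disj del: of_nat_Suc)
    show "adapted_on F {..\<infinity>} (\<lambda>s \<omega>. ?Y n (min s ?N) \<omega>)"
      unfolding adapted_on_def
    proof
      fix s :: ennreal
      show "(\<lambda>\<omega>. ?Y n (min s ?N) \<omega>) \<in> borel_measurable (F s)"
        using N by (intro measurable_F_mono[OF martingale_on_measurable[OF m]]) auto
    qed
    show "integrable P (\<lambda>\<omega>. ?Y n (min s ?N) \<omega>)" for s
      using N by (intro martingale_on_integrable[OF m]) auto
    fix s u :: ennreal and A assume "s \<le> u" and A: "A \<in> sets (F s)"
    show "(\<integral>\<omega>. indicator A \<omega> * ?Y n (min u ?N) \<omega> \<partial>P) = (\<integral>\<omega>. indicator A \<omega> * ?Y n (min s ?N) \<omega> \<partial>P)"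
    proof (cases "s \<le> ?N")
      case True
      then show ?thesis
        using N A \<open>s \<le> u\<close> le_less_trans[OF True N(1)] by (intro set_integral_martingale[OF m, symmetric]) (auto simp: min_absorb1)
    next
      case False
      with \<open>s \<le> u\<close> have "min u ?N = ?N" "min s ?N = ?N" by (auto simp: min_def)
      then show ?thesis by simp
    qed
  qed
  also have "(\<lambda>s \<omega>. ?Y n (min s (of_nat (Suc n))) \<omega>) =
      (\<lambda>s \<omega>. indicator {\<omega>. 0 < \<sigma> n \<omega>} \<omega> * stopped (closed_at_infinity X) (\<sigma> n) s \<omega>)" for n
  proof (intro ext)
    fix s \<omega>
    have fin: "min (min s (of_nat (Suc n))) (\<tau> n \<omega>) \<noteq> (\<infinity>::ennreal)"
      using of_nat_less_top[of "Suc n"] by (intro less_imp_neq) (simp add: min_less_iff_disj del: of_nat_Suc)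
    have "min s (\<sigma> n \<omega>) = min (min s (of_nat (Suc n))) (\<tau> n \<omega>)"
      by (simp add: \<sigma>_def ac_simps)
    moreover have "0 < \<sigma> n \<omega> \<longleftrightarrow> 0 < \<tau> n \<omega>" by (simp add: \<sigma>_def add_pos_nonneg)
    ultimately show "?Y n (min s (of_nat (Suc n))) \<omega> =
        indicator {\<omega>. 0 < \<sigma> n \<omega>} \<omega> * stopped (closed_at_infinity X) (\<sigma> n) s \<omega>"
      using fin by (simp add: stopped_def closed_at_infinity_def indicator_def)
  qed
  finally show ?thesis
    unfolding local_martingale_on_def
    using \<sigma>_st \<sigma>_lim adapted_on_closed_at_infinity[OF ad lim] by blast
qed

end

section \<open>Strict local martingales with large maxima\<close>

theorem proposition1:
  fixes P :: "'a measure"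
    and F :: "ennreal \<Rightarrow> 'a measure"
    and M :: "ennreal \<Rightarrow> 'a \<Rightarrow> real"
  assumes "usual_filtered_prob_space P F"
    and "local_martingale_on P F {..<\<infinity>} M"
    and "right_continuous_paths P M"
  shows
    "(\<forall>t<\<infinity>. \<forall>\<alpha>\<in>{0<..<1}.
        expected_sup_powr P M (\<lambda>_. t) \<alpha> = \<infinity> \<longrightarrow>
        strict_local_martingale_on P F {..t} M)
     \<and>
     (\<forall>T. \<forall>t0<\<infinity>. \<forall>\<alpha>\<in>{0<..<1}.
        stopping_time F T \<and> (AE \<omega> in P. T \<omega> < \<infinity>) \<and> (AE \<omega> in P. T \<omega> \<le> t0) \<and>
        expected_sup_powr P M T \<alpha> = \<infinity> \<longrightarrow>
        strict_local_martingale_on P F {..t0} (stopped M T) \<and>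
        Limsup at_top (\<lambda>c::real. ereal (c * sup_tail P M T c)) = \<infinity>)
     \<and>
     (\<forall>\<alpha>\<in>{0<..<1}.
        has_limit_at_infinity P M \<and>
        expected_sup_powr P (closed_at_infinity M) (\<lambda>_. \<infinity>) \<alpha> = \<infinity> \<longrightarrow>
        strict_local_martingale_on P F {..\<infinity>} (stopped (closed_at_infinity M) (\<lambda>_. \<infinity>)) \<and>
        Limsup at_top (\<lambda>c::real. ereal (c * sup_tail P (closed_at_infinity M) (\<lambda>_. \<infinity>) c)) = \<infinity>)"
proof -
  interpret usual_filtered_prob_space P F by fact
  have local: "local_martingale_on P F {..t} M" if "t < \<infinity>" for t
    using that by (intro local_martingale_on_subset[OF assms(2)]) auto
  show ?thesis
  proof (intro conjI allI ballI impI; (elim conjE)?)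
    fix t :: ennreal and \<alpha> :: real
    assume "t < \<infinity>" "\<alpha> \<in> {0<..<1}" "expected_sup_powr P M (\<lambda>_. t) \<alpha> = \<infinity>"
    then show "strict_local_martingale_on P F {..t} M"
      by (intro strict_local_martingale_if_moment_infinite[OF local assms(3), of t \<alpha>]) auto
  next
    fix T :: "'a \<Rightarrow> ennreal" and t0 :: ennreal and \<alpha> :: real
    assume t0: "t0 < \<infinity>" and \<alpha>: "\<alpha> \<in> {0<..<1}" and T: "stopping_time F T" "AE \<omega> in P. T \<omega> \<le> t0"
      and inf: "expected_sup_powr P M T \<alpha> = \<infinity>"
    have lm: "local_martingale_on P F {..t0} (stopped M T)"
      by (rule local_martingale_on_stopped[OF local[OF t0] _ assms(3) T(1)]) auto
    then have ad: "adapted_on F {..t0} (stopped M T)" by (simp add: local_martingale_on_def)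
    have rc: "right_continuous_paths P (stopped M T)"
      by (rule right_continuous_paths_stopped[OF assms(3)])
    have "expected_sup_powr P (stopped M T) (\<lambda>_. t0) \<alpha> = \<infinity>"
      using inf by (simp add: expected_sup_powr_stopped[OF T(2)])
    note strict = strict_local_martingale_if_moment_infinite[OF lm rc _ _ this]
    show "strict_local_martingale_on P F {..t0} (stopped M T)"
      using \<alpha> by (intro strict) auto
    show "Limsup at_top (\<lambda>c::real. ereal (c * sup_tail P M T c)) = \<infinity>"
      using strict(2) \<alpha> by (simp add: sup_tail_stopped[OF T(2) ad rc])
  next
    fix \<alpha> :: real
    assume \<alpha>: "\<alpha> \<in> {0<..<1}" and lim: "has_limit_at_infinity P M"
      and inf: "expected_sup_powr P (closed_at_infinity M) (\<lambda>_. \<infinity>) \<alpha> = \<infinity>"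
    have eq: "stopped (closed_at_infinity M) (\<lambda>_. \<infinity>) = closed_at_infinity M"
      by (intro ext) (simp add: stopped_def)
    note strict = strict_local_martingale_if_moment_infinite[
      OF local_martingale_on_closed_at_infinity[OF assms(2) lim]
        right_continuous_paths_closed_at_infinity[OF assms(3)] _ _ inf]
    show "strict_local_martingale_on P F {..\<infinity>} (stopped (closed_at_infinity M) (\<lambda>_. \<infinity>))"
      unfolding eq using \<alpha> by (intro strict) auto
    show "Limsup at_top (\<lambda>c::real. ereal (c * sup_tail P (closed_at_infinity M) (\<lambda>_. \<infinity>) c)) = \<infinity>"
      using \<alpha> by (intro strict) auto
  qed
qed

end
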